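(* Consider a fast-slow system in $\mathbb{R}^3$ with two fast variables $x=(x_1,x_2)\in\mathbb{R}^2$ and one slow variable $y\in\mathbb{R}$, $$x_1'=f_1(x,y),\qquad x_2'=f_2(x,y),\qquad y'=\epsilon\, g(x,y),$$ where $f=(f_1,f_2)$ and $g$ are sufficiently smooth, with flow $\phi_\epsilon$ on $\mathbb{R}^3$. Let $K>0$ and $N:=[-K,K]^2\times[-K,0]\subset\mathbb{R}^3$. Assume: (B1) For some $\delta_0>0$ there exists a family of hyperbolic periodic orbits $\{\gamma_y\}$, $y\in[-\delta_0,\delta_0]$, in the fast subsystem, where $\gamma_y(t)\in\mathbb{R}^2$ has period $T_y$, so that $\gamma_y(0)=\gamma_y(T_y)$ and $\gamma_y'(t)=f(\gamma_y(t),y)$. (B2) $\{\gamma_y\}_{y\in[-\delta_0,0]}\subset N$ and $\gamma_0\subset\mathrm{int}([-K,K]^2\times\{0\})$. Assume moreover that $$\frac{1}{T_0}\int_0^{T_0} g(\gamma_0(s),0)\,ds>0.$$ Then all points in $\gamma_0$ are slow exit points for $N$.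
   Context: Here $'=d/dt$ and $0<\epsilon\ll1$. For $\epsilon\ge0$, $\phi_\epsilon:\mathbb{R}\times\mathbb{R}^3\to\mathbb{R}^3$ is the flow of the system. The fast subsystem is the system with $\epsilon=0$, i.e. $x'=f(x,y)$, $y'=0$, a family of planar ODEs parametrized by $y$, with flow $\phi_0$. A periodic orbit $\gamma_y$ of the planar system $x'=f(x,y)$ is identified with the subset $\{(\gamma_y(t),y): t\in\mathbb{R}\}$ of $\mathbb{R}^3$. In (B2), the interior of $[-K,K]^2\times\{0\}$ is taken relative to the plane $\{y=0\}$. Hyperbolic means hyperbolic as a periodic orbit of the planar system $x'=f(x,y)$ with $y$ fixed. For a flow $\phi$ and a compact set $N$, $\mathrm{Inv}(N,\phi)=\{z : \phi(\mathbb{R},z)\subset N\}$. Slow exit points: let $N$ be compact and $z\in \mathrm{Inv}(N,\phi_0)$. The point $z$ is a slow exit point (for $N$) if there are a neighbourhood $U$ of $z$ and an $\bar\epsilon>0$ such that for all $\epsilon\in(0,\bar\epsilon]$ there is a time $T(\epsilon,U)>0$ with $\phi_\epsilon(T(\epsilon,U),U)\cap U=\emptyset$. *)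

theory Defs
  imports
    "HOL-Analysis.Analysis"
    "HOL-Computational_Algebra.Polynomial"
begin

text \<open>
  The phase space \<open>\<real>\<^sup>3\<close> is \<open>(real^2) \<times> real\<close>, with points \<open>(x, y)\<close>: \<open>x\<close> fast, \<open>y\<close> slow.
  The product carries the Euclidean norm.
\<close>

type_synonym phase = "(real^2) \<times> real"

text \<open>
  Class \<open>C\<^sup>1\<close> on the whole space; this is the reading of ``sufficiently smooth'' used here, being
  the weakest degree of smoothness for which the linearisation along an orbit is continuous.
\<close>

definition C1_map :: "('a::real_normed_vector \<Rightarrow> 'b::real_normed_vector) \<Rightarrow> bool" where
  "C1_map h \<longleftrightarrow>
     (\<exists>h' :: 'a \<Rightarrow> 'a \<Rightarrow>\<^sub>L 'b.
        (\<forall>z. (h has_derivative blinfun_apply (h' z)) (at z)) \<and> continuous_on UNIV h')"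

definition fast_slow_field ::
    "(phase \<Rightarrow> real^2) \<Rightarrow> (phase \<Rightarrow> real) \<Rightarrow> real \<Rightarrow> phase \<Rightarrow> phase" where
  "fast_slow_field f g \<epsilon> z = (f z, \<epsilon> * g z)"

text \<open>
  The global flow of \<open>z' = F z\<close>. For \<open>C\<^sup>1\<close> fields solutions are unique, so the group law and
  the continuity of the flow are consequences and are not listed.
\<close>

definition flow_of :: "('a::real_normed_vector \<Rightarrow> 'a) \<Rightarrow> (real \<Rightarrow> 'a \<Rightarrow> 'a) \<Rightarrow> bool" where
  "flow_of F \<phi> \<longleftrightarrow>
     (\<forall>z. \<phi> 0 z = z \<and>
          (\<forall>t. ((\<lambda>s. \<phi> s z) has_vector_derivative F (\<phi> t z)) (at t)))"

definition Inv :: "'a set \<Rightarrow> (real \<Rightarrow> 'a \<Rightarrow> 'a) \<Rightarrow> 'a set" where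
  "Inv N \<phi> = {z. \<forall>t. \<phi> t z \<in> N}"

text \<open>In \<open>slow_exit_point\<close>, \<open>\<phi> \<epsilon>\<close> is the flow for the parameter value \<open>\<epsilon>\<close>.\<close>

definition slow_exit_point ::
    "(real \<Rightarrow> real \<Rightarrow> 'a \<Rightarrow> 'a) \<Rightarrow> 'a::topological_space set \<Rightarrow> 'a \<Rightarrow> bool" where
  "slow_exit_point \<phi> N z \<longleftrightarrow>
     compact N \<and> z \<in> Inv N (\<phi> 0) \<and>
     (\<exists>U. z \<in> interior U \<and>
        (\<exists>\<epsilon>\<^sub>0>0. \<forall>\<epsilon>. 0 < \<epsilon> \<and> \<epsilon> \<le> \<epsilon>\<^sub>0 \<longrightarrow>
           (\<exists>T>0. \<phi> \<epsilon> T ` U \<inter> U = {})))"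

text \<open>\<open>T\<close> is a period, not necessarily the least one; equilibria are not periodic orbits.\<close>

definition periodic_orbit ::
    "('a::real_normed_vector \<Rightarrow> 'a) \<Rightarrow> (real \<Rightarrow> 'a) \<Rightarrow> real \<Rightarrow> bool" where
  "periodic_orbit h \<gamma> T \<longleftrightarrow>
     T > 0 \<and>
     (\<forall>t. (\<gamma> has_vector_derivative h (\<gamma> t)) (at t)) \<and>
     (\<forall>t. \<gamma> (t + T) = \<gamma> t) \<and>
     \<not> \<gamma> constant_on UNIV"

text \<open>
  \<open>M\<close> is the monodromy matrix: the value at time \<open>T\<close> of the fundamental matrix solution,
  with \<open>X 0 = I\<close>, of the variational equation along \<open>\<gamma>\<close>.
\<close>

definition monodromy_matrix ::
    "(real^'n \<Rightarrow> real^'n) \<Rightarrow> (real \<Rightarrow> real^'n) \<Rightarrow> real \<Rightarrow> real^'n^'n \<Rightarrow> bool" where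
  "monodromy_matrix h \<gamma> T M \<longleftrightarrow>
     (\<exists>X. X 0 = mat 1 \<and>
          (\<forall>t. (X has_vector_derivative jacobian h (at (\<gamma> t)) ** X t) (at t)) \<and>
          X T = M)"

definition complex_charpoly :: "real^'n^'n \<Rightarrow> complex poly" where
  "complex_charpoly M = det (mat [:0, 1:] - (\<chi> i j. [:complex_of_real (M $ i $ j):]))"

text \<open>
  The Floquet multipliers are the complex eigenvalues of the monodromy matrix. Hyperbolicity:
  the trivial multiplier 1 is algebraically simple and is the only multiplier on the unit circle.
\<close>

definition hyperbolic_periodic_orbit ::
    "(real^'n \<Rightarrow> real^'n) \<Rightarrow> (real \<Rightarrow> real^'n) \<Rightarrow> real \<Rightarrow> bool" where
  "hyperbolic_periodic_orbit h \<gamma> T \<longleftrightarrow>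
     periodic_orbit h \<gamma> T \<and>
     (\<exists>M. monodromy_matrix h \<gamma> T M \<and>
          order 1 (complex_charpoly M) = 1 \<and>
          (\<forall>\<mu>. poly (complex_charpoly M) \<mu> = 0 \<and> cmod \<mu> = 1 \<longrightarrow> \<mu> = 1))"

definition square :: "real \<Rightarrow> (real^2) set" where
  "square K = {x. \<forall>i. x $ i \<in> {-K..K}}"

definition lifted_orbit :: "(real \<Rightarrow> real \<Rightarrow> real^2) \<Rightarrow> real \<Rightarrow> phase set" where
  "lifted_orbit \<gamma> y = range (\<lambda>t. (\<gamma> y t, y))"

end

theory Submission
  imports Defs
begin

text \<open>
  The normal Floquet multiplier \<open>\<mu>\<close> of the planar orbit \<open>\<Gamma> = \<gamma>\<^sub>0\<close> is real with
  \<open>\<bar>\<mu>\<bar> \<noteq> 1\<close>, so \<open>\<Gamma>\<close> attracts nearby points of the plane \<open>y = 0\<close> either in forward or in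
  backward time. The condition \<open>\<phi>\<^sub>\<epsilon>(t, U) \<inter> U = \<emptyset>\<close> is equivalent to
  \<open>\<phi>\<^sub>\<epsilon>(-t, U) \<inter> U = \<emptyset>\<close>, and the substitution \<open>(x, y, t) \<mapsto> (x, -y, -t)\<close> turns a fast-slow
  system with a repelling orbit into one with an attracting orbit and leaves the average of \<open>g\<close>
  unchanged. Hence only the attracting case needs an argument.

  In the attracting case some multiple \<open>\<tau>\<close> of the period halves the distance to \<open>\<Gamma>\<close> of every
  point in a tube around \<open>\<Gamma>\<close> (\<open>orbit_contraction\<close>). Halving leaves room for perturbation: for
  small \<open>\<epsilon>\<close> and small \<open>\<bar>y\<bar>\<close> the time-\<open>\<tau>\<close> map of the full system still maps the tube into
  itself. Along the way the solution stays close to \<open>\<Gamma>\<close>, so \<open>g\<close> is close to its values on the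
  orbit, and as \<open>\<tau>\<close> is a multiple of the period, \<open>y\<close> grows by an amount between \<open>c \<epsilon>\<close> and
  \<open>C \<epsilon>\<close> with \<open>c, C > 0\<close> (\<open>drift_step\<close>). Start in a ball of radius \<open>r\<close> around a point of
  \<open>\<Gamma> \<times> {0}\<close>. After about \<open>2 r / (c \<epsilon>)\<close> such steps, \<open>y\<close> has grown by at least \<open>2 r\<close>, so the
  whole ball has left itself, while the total growth is at most about \<open>2 r C / c\<close>, which is
  within the range of \<open>y\<close> where the step estimate holds when \<open>r\<close> is small (\<open>exit_time\<close>).
  A suitable number of steps depends on \<open>\<epsilon>\<close> but not on the initial point, which is what a slow
  exit point asks for.

  The contraction comes from the derivative of the time-\<open>T\<close> map at \<open>\<gamma>\<^sub>0(0)\<close>, which is the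
  monodromy matrix (\<open>flow_has_derivative\<close>). Its iterates shrink everything except the component
  along the velocity of the orbit, and moving along the velocity is, to first order, moving along
  \<open>\<Gamma>\<close> (\<open>contraction_at_fixed_point\<close>). The flow itself carries this estimate from
  \<open>\<gamma>\<^sub>0(0)\<close> to all other points of \<open>\<Gamma>\<close>.
\<close>


section \<open>Comparison of solutions\<close>

text \<open>
  A \<open>C\<^sup>1\<close> field need not be globally Lipschitz. The weaker property suffices for the comparison of
  solutions near a bounded one, and it passes from \<open>f\<close> and \<open>g\<close> to the field of the whole system.
\<close>

definition lipschitz_on_balls :: "('a::real_normed_vector \<Rightarrow> 'b::real_normed_vector) \<Rightarrow> bool" where
  "lipschitz_on_balls F \<longleftrightarrow> (\<forall>R. \<exists>L. L-lipschitz_on (cball 0 R) F)"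

lemma derivative_bounded_on_balls:
  fixes F :: "'a::euclidean_space \<Rightarrow> 'b::real_normed_vector"
  assumes der: "\<And>z. (F has_derivative blinfun_apply (F' z)) (at z)"
    and cont: "continuous_on UNIV F'"
  obtains L where "\<And>z. z \<in> cball 0 R \<Longrightarrow> norm (F' z) \<le> L" "L-lipschitz_on (cball 0 R) F"
proof -
  have "compact (F' ` cball 0 R)"
    by (intro compact_continuous_image continuous_on_subset[OF cont]) auto
  then obtain B where B: "B > 0" "\<And>z. z \<in> cball 0 R \<Longrightarrow> norm (F' z) \<le> B"
    using compact_imp_bounded bounded_pos by (metis imageI)
  have "B-lipschitz_on (cball 0 R) F"
    using B der
    by (intro bounded_derivative_imp_lipschitz[where f' = "\<lambda>z. blinfun_apply (F' z)"])
       (auto intro: has_derivative_at_withinI simp flip: norm_blinfun.rep_eq)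
  with B show thesis using that by blast
qed

lemma C1_map_lipschitz_on_balls:
  fixes F :: "'a::euclidean_space \<Rightarrow> 'b::real_normed_vector"
  assumes "C1_map F"
  shows "lipschitz_on_balls F"
  using assms derivative_bounded_on_balls unfolding C1_map_def lipschitz_on_balls_def by metis

text \<open>
  Gronwall's inequality for the square of the norm, which is differentiable where the norm need not
  be. The rate \<open>2 L + 1\<close> arises from \<open>2 L \<bar>e\<bar>\<^sup>2 + 2 \<bar>e\<bar> \<eta> \<le> (2 L + 1) \<bar>e\<bar>\<^sup>2 + \<eta>\<^sup>2\<close>.
\<close>

lemma gronwall_square:
  fixes e :: "real \<Rightarrow> 'a::real_inner"
  assumes der: "\<And>s. 0 \<le> s \<Longrightarrow> s \<le> t \<Longrightarrow> (e has_vector_derivative e' s) (at s)"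
    and bd: "\<And>s. 0 \<le> s \<Longrightarrow> s \<le> t \<Longrightarrow> norm (e' s) \<le> L * norm (e s) + \<eta>"
    and t: "0 \<le> t" and L: "0 \<le> L"
  shows "(norm (e t))\<^sup>2 \<le> ((norm (e 0))\<^sup>2 + \<eta>\<^sup>2 * t) * exp ((2 * L + 1) * t)"
proof -
  define q where "q s = (e s \<bullet> e s) * exp (- ((2 * L + 1) * s)) - \<eta>\<^sup>2 * s" for s
  have "q t \<le> q 0"
  proof (rule DERIV_nonpos_imp_nonincreasing[OF t])
    fix s assume s: "0 \<le> s" "s \<le> t"
    let ?E = "exp (- ((2 * L + 1) * s))"
    let ?d = "(2 * (e s \<bullet> e' s) - (2 * L + 1) * (e s \<bullet> e s)) * ?E - \<eta>\<^sup>2"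
    have "((\<lambda>s. e s \<bullet> e s) has_real_derivative 2 * (e s \<bullet> e' s)) (at s)"
      using has_derivative_inner[OF der[OF s, unfolded has_vector_derivative_def]
              der[OF s, unfolded has_vector_derivative_def]]
      unfolding has_field_derivative_def
      by (rule has_derivative_eq_rhs) (auto simp: inner_commute algebra_simps)
    then have "(q has_real_derivative ?d) (at s)"
      unfolding q_def by (auto intro!: derivative_eq_intros simp: algebra_simps)
    moreover have "?d \<le> 0"
    proof -
      have "e s \<bullet> e' s \<le> norm (e s) * (L * norm (e s) + \<eta>)"
        using norm_cauchy_schwarz[of "e s" "e' s"] mult_left_mono[OF bd[OF s] norm_ge_zero[of "e s"]]
        by linarith
      moreover have "2 * (norm (e s) * \<eta>) \<le> (norm (e s))\<^sup>2 + \<eta>\<^sup>2"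
        using sum_squares_bound[of "norm (e s)" \<eta>] by simp
      ultimately have "2 * (e s \<bullet> e' s) - (2 * L + 1) * (e s \<bullet> e s) \<le> \<eta>\<^sup>2"
        by (simp add: dot_square_norm algebra_simps power2_eq_square)
      moreover have "?E \<le> 1" using s L by simp
      ultimately have "(2 * (e s \<bullet> e' s) - (2 * L + 1) * (e s \<bullet> e s)) * ?E \<le> \<eta>\<^sup>2 * 1"
        by (meson exp_ge_zero mult_left_mono mult_right_mono order_trans zero_le_power2)
      then show ?thesis by simp
    qed
    ultimately show "\<exists>y. (q has_real_derivative y) (at s) \<and> y \<le> 0" by blast
  qed
  then have "(e t \<bullet> e t) * exp (- ((2 * L + 1) * t)) \<le> e 0 \<bullet> e 0 + \<eta>\<^sup>2 * t"
    by (simp add: q_def)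
  then have "(e t \<bullet> e t) * exp (- ((2 * L + 1) * t)) * exp ((2 * L + 1) * t)
      \<le> (e 0 \<bullet> e 0 + \<eta>\<^sup>2 * t) * exp ((2 * L + 1) * t)"
    by (rule mult_right_mono) simp
  then show ?thesis by (simp add: dot_square_norm mult.assoc flip: exp_add)
qed

text \<open>
  The fields are compared on a ball only, so Gronwall's inequality applies only as long as the
  perturbed solution \<open>w\<close> stays in the ball. It does stay there: at the first time at which the
  distance between \<open>w\<close> and \<open>u\<close> were \<open>\<delta>\<close>, the Gronwall bound on the interval up to that time
  would make it smaller than \<open>\<delta>\<close>.
\<close>

lemma solution_comparison:
  fixes F G :: "'a::real_inner \<Rightarrow> 'a"
  assumes lip: "L-lipschitz_on (cball 0 R) F"
    and u: "\<And>t. (u has_vector_derivative F (u t)) (at t)"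
    and w: "\<And>t. (w has_vector_derivative G (w t)) (at t)"
    and inside: "\<And>t. 0 \<le> t \<Longrightarrow> t \<le> b \<Longrightarrow> norm (u t) + \<delta> \<le> R"
    and diff: "\<And>z. z \<in> cball 0 R \<Longrightarrow> norm (G z - F z) \<le> \<eta>"
    and small: "((norm (w 0 - u 0))\<^sup>2 + \<eta>\<^sup>2 * b) * exp ((2 * L + 1) * b) < \<delta>\<^sup>2"
    and \<delta>: "0 < \<delta>" and t: "0 \<le> t" "t \<le> b"
  shows "(norm (w t - u t))\<^sup>2 \<le> ((norm (w 0 - u 0))\<^sup>2 + \<eta>\<^sup>2 * t) * exp ((2 * L + 1) * t)"
    and "norm (w t - u t) < \<delta>"
proof -
  have L: "0 \<le> L" using lip by (rule lipschitz_on_nonneg)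
  define e where "e t = w t - u t" for t
  have e: "(e has_vector_derivative G (w t) - F (u t)) (at t)" for t
    unfolding e_def by (intro has_vector_derivative_diff u w)
  have cont: "continuous_on S (\<lambda>s. norm (e s))" for S
    using e by (intro continuous_on_norm)
      (meson continuous_at_imp_continuous_on has_vector_derivative_continuous)
  have bound: "(norm (e c))\<^sup>2 \<le> ((norm (e 0))\<^sup>2 + \<eta>\<^sup>2 * c) * exp ((2 * L + 1) * c)"
    if c: "0 \<le> c" "c \<le> b" and le: "\<And>s. 0 \<le> s \<Longrightarrow> s \<le> c \<Longrightarrow> norm (e s) \<le> \<delta>" for c
  proof (rule gronwall_square[OF e _ c(1) L])
    fix s assume s: "0 \<le> s" "s \<le> c"
    have us: "norm (u s) + \<delta> \<le> R" using inside s c by simp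
    have in1: "u s \<in> cball 0 R" using us \<delta> by simp
    have "norm (w s) \<le> norm (u s) + norm (e s)"
      unfolding e_def using norm_triangle_sub by blast
    then have in2: "w s \<in> cball 0 R" using us le[OF s] by simp
    have "norm (G (w s) - F (u s)) \<le> norm (G (w s) - F (w s)) + norm (F (w s) - F (u s))"
      by (rule norm_diff_triangle_le[where y="F (w s)"]) auto
    also have "\<dots> \<le> \<eta> + L * norm (e s)"
      using diff[OF in2] lipschitz_onD[OF lip in2 in1] by (simp add: e_def dist_norm)
    finally show "norm (G (w s) - F (u s)) \<le> L * norm (e s) + \<eta>" by simp
  qed
  have mono: "((norm (e 0))\<^sup>2 + \<eta>\<^sup>2 * c) * exp ((2 * L + 1) * c)
      \<le> ((norm (e 0))\<^sup>2 + \<eta>\<^sup>2 * b) * exp ((2 * L + 1) * b)" if "0 \<le> c" "c \<le> b" for c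
    using that L by (intro mult_mono) (auto intro: mult_left_mono)
  have close: "norm (e s) < \<delta>" if s: "0 \<le> s" "s \<le> b" for s
  proof (rule ccontr)
    assume "\<not> norm (e s) < \<delta>"
    then have s\<delta>: "\<delta> \<le> norm (e s)" by simp
    have "(norm (e 0))\<^sup>2 \<le> ((norm (e 0))\<^sup>2 + \<eta>\<^sup>2 * b) * exp ((2 * L + 1) * b)"
      using mono[of 0] s by simp
    then have "(norm (e 0))\<^sup>2 < \<delta>\<^sup>2" using small e_def by simp
    then have e0: "norm (e 0) < \<delta>" using \<delta> by (simp add: power2_less_imp_less)
    \<comment> \<open>The distance starts below \<open>\<delta>\<close>, so the first time in \<open>S\<close> is the first time at which it reaches \<open>\<delta>\<close>.\<close>
    define S where "S = {s \<in> {0..b}. norm (e s) = \<delta>}"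
    have hit: "\<exists>c \<in> S. c \<le> r" if "0 \<le> r" "r \<le> b" "\<delta> \<le> norm (e r)" for r
      using IVT'[OF less_imp_le[OF e0] that(3) that(1) cont] that unfolding S_def by force
    have "compact S"
    proof -
      have "closed S"
        unfolding S_def
        by (rule continuous_closed_preimage_constant[OF cont]) simp
      then show ?thesis unfolding compact_eq_bounded_closed
        by (auto simp: S_def intro: bounded_subset[OF bounded_closed_interval[of 0 b]])
    qed
    moreover have "S \<noteq> {}" using hit[OF s s\<delta>] by blast
    ultimately have "\<exists>c\<in>S. \<forall>r\<in>S. c \<le> r" by (rule compact_attains_inf)
    then obtain c where c: "c \<in> S" "\<And>r. r \<in> S \<Longrightarrow> c \<le> r" by blast
    have cb: "0 \<le> c" "c \<le> b" "norm (e c) = \<delta>" using c(1) by (auto simp: S_def)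
    have "norm (e r) \<le> \<delta>" if r: "0 \<le> r" "r \<le> c" for r
    proof (rule ccontr)
      assume "\<not> norm (e r) \<le> \<delta>"
      then have r\<delta>: "\<delta> < norm (e r)" by simp
      have "r \<le> b" using r cb by simp
      then obtain c' where "c' \<in> S" "c' \<le> r" using hit[OF r(1)] r\<delta> by auto
      then have "r = c" using c(2) r by force
      then show False using r\<delta> cb by simp
    qed
    from bound[OF cb(1,2) this] mono[OF cb(1,2)] small cb(3) show False
      by (simp add: e_def)
  qed
  show "norm (w t - u t) < \<delta>" using close[OF t] by (simp add: e_def)
  show "(norm (w t - u t))\<^sup>2 \<le> ((norm (w 0 - u 0))\<^sup>2 + \<eta>\<^sup>2 * t) * exp ((2 * L + 1) * t)"
    using bound[OF t] close t by (force simp: e_def)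
qed

lemma has_vector_derivative_affine:
  fixes u :: "real \<Rightarrow> 'a::real_normed_vector"
  assumes "(u has_vector_derivative D) (at (a + c * t))"
  shows "((\<lambda>s. u (a + c * s)) has_vector_derivative c *\<^sub>R D) (at t)"
proof -
  have "((\<lambda>s. a + c * s) has_vector_derivative c) (at t)"
    unfolding has_real_derivative_iff_has_vector_derivative[symmetric]
    by (auto intro!: derivative_eq_intros)
  from vector_diff_chain_at[OF this assms] show ?thesis by (simp add: o_def)
qed

lemma lipschitz_on_balls_uminus:
  "lipschitz_on_balls F \<Longrightarrow> lipschitz_on_balls (\<lambda>z. - F z)"
  unfolding lipschitz_on_balls_def lipschitz_on_def by (simp add: dist_minus)

lemma reversed_solution:
  assumes "\<And>t. (u has_vector_derivative F (u t)) (at t)"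
  shows "((\<lambda>t. u (- t)) has_vector_derivative - F (u (- t))) (at t)"
  using has_vector_derivative_affine[of u "F (u (- t))" 0 "-1" t] assms by simp

lemma shifted_solution:
  assumes "\<And>t. (u has_vector_derivative F (u t)) (at t)"
  shows "((\<lambda>t. u (s + t)) has_vector_derivative F (u (s + t))) (at t)"
  using has_vector_derivative_affine[of u "F (u (s + t))" s 1 t] assms by simp

lemma solution_bounded:
  assumes "\<And>t. (u has_vector_derivative F (u t)) (at t)"
  obtains B where "\<And>t. 0 \<le> t \<Longrightarrow> t \<le> b \<Longrightarrow> norm (u t) \<le> B"
proof -
  have "continuous_on {0..b} u"
    using assms by (meson continuous_at_imp_continuous_on has_vector_derivative_continuous)
  then have "bounded (u ` {0..b})"
    by (intro compact_imp_bounded compact_continuous_image) auto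
  then obtain B where "\<And>t. t \<in> {0..b} \<Longrightarrow> norm (u t) \<le> B"
    unfolding bounded_iff by blast
  then show thesis by (intro that) auto
qed

lemma solution_unique:
  fixes F :: "'a::real_inner \<Rightarrow> 'a"
  assumes lip: "lipschitz_on_balls F"
    and u: "\<And>t. (u has_vector_derivative F (u t)) (at t)"
    and w: "\<And>t. (w has_vector_derivative F (w t)) (at t)"
    and init: "u 0 = w 0"
  shows "u t = w t"
proof -
  have *: "u t = w t"
    if lip: "lipschitz_on_balls F" and "0 \<le> t" "u 0 = w 0"
      and u: "\<And>t. (u has_vector_derivative F (u t)) (at t)"
      and w: "\<And>t. (w has_vector_derivative F (w t)) (at t)"
    for F :: "'a \<Rightarrow> 'a" and u w and t :: real
  proof -
    obtain B where B: "\<And>s. 0 \<le> s \<Longrightarrow> s \<le> t \<Longrightarrow> norm (u s) \<le> B"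
      by (rule solution_bounded[OF u]) blast
    obtain L where L: "L-lipschitz_on (cball 0 (B + 1)) F"
      using lip unfolding lipschitz_on_balls_def by blast
    have "(norm (w t - u t))\<^sup>2
        \<le> ((norm (w 0 - u 0))\<^sup>2 + 0\<^sup>2 * t) * exp ((2 * L + 1) * t)"
      by (rule solution_comparison(1)[OF L u w, where b = t and \<delta> = 1])
         (use B that in auto)
    then show ?thesis using that by simp
  qed
  show ?thesis
  proof (cases "0 \<le> t")
    case True
    then show ?thesis using * assms by blast
  next
    case False
    have "u (- (- t)) = w (- (- t))"
      using *[OF lipschitz_on_balls_uminus[OF lip], of "- t" "\<lambda>t. u (- t)" "\<lambda>t. w (- t)"]
        reversed_solution[of u F, OF u] reversed_solution[of w F, OF w] init False by simp
    then show ?thesis by simp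
  qed
qed

lemma flow_ofD:
  assumes "flow_of F \<phi>"
  shows "\<phi> 0 z = z" "((\<lambda>s. \<phi> s z) has_vector_derivative F (\<phi> t z)) (at t)"
  using assms by (auto simp: flow_of_def)

lemma flow_of_solution:
  fixes F :: "'a::real_inner \<Rightarrow> 'a"
  assumes "lipschitz_on_balls F" "flow_of F \<phi>"
    and "\<And>t. (u has_vector_derivative F (u t)) (at t)"
  shows "\<phi> t (u s) = u (s + t)"
  by (rule solution_unique[OF assms(1) _ shifted_solution[of u F, OF assms(3)]])
     (simp_all add: flow_ofD[OF assms(2)])

lemma flow_of_add:
  fixes F :: "'a::real_inner \<Rightarrow> 'a"
  assumes "lipschitz_on_balls F" "flow_of F \<phi>"
  shows "\<phi> t (\<phi> s z) = \<phi> (s + t) z"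
  by (rule flow_of_solution[OF assms flow_ofD(2)[OF assms(2)]])

lemma flow_of_reversed:
  fixes F :: "'a::real_inner \<Rightarrow> 'a"
  assumes "flow_of F \<phi>"
  shows "flow_of (\<lambda>z. - F z) (\<lambda>t. \<phi> (- t))"
  unfolding flow_of_def
  using flow_ofD[OF assms] reversed_solution[of "\<lambda>t. \<phi> t _" F] by simp

text \<open>
  Differentiability of the flow in the initial value, at a point \<open>u 0\<close> whose variational equation
  has the solutions \<open>Y t v\<close>: the remainder \<open>r = \<psi> t x - u t - Y t v\<close> with \<open>v = x - u 0\<close> solves the
  variational equation up to an error \<open>o(\<bar>v\<bar>)\<close>, by uniform continuity of \<open>F'\<close> near the orbit
  segment, and \<open>r 0 = 0\<close>.
\<close>

lemma flow_has_derivative: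
  fixes F :: "'a::euclidean_space \<Rightarrow> 'a"
  assumes der: "\<And>z. (F has_derivative blinfun_apply (F' z)) (at z)"
    and cont: "continuous_on UNIV F'"
    and flow: "flow_of F \<psi>"
    and u: "\<And>t. (u has_vector_derivative F (u t)) (at t)"
    and Y0: "\<And>v. Y 0 v = v"
    and Y: "\<And>t v. ((\<lambda>t. Y t v) has_vector_derivative F' (u t) (Y t v)) (at t)"
    and lin: "bounded_linear (Y b)" and b: "0 \<le> b"
  shows "(\<psi> b has_derivative Y b) (at (u 0))"
  unfolding has_derivative_at_alt
proof (intro conjI lin allI impI)
  fix e :: real assume e: "0 < e"
  obtain B where B: "\<And>s. 0 \<le> s \<Longrightarrow> s \<le> b \<Longrightarrow> norm (u s) \<le> B"
    by (rule solution_bounded[OF u]) blast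
  define R where "R = B + 1"
  obtain L where L: "\<And>z. z \<in> cball 0 R \<Longrightarrow> norm (F' z) \<le> L" and
      lip: "L-lipschitz_on (cball 0 R) F"
    using derivative_bounded_on_balls[OF der cont] by metis
  have L0: "0 \<le> L" using lip by (rule lipschitz_on_nonneg)
  have lipF: "lipschitz_on_balls F"
    using C1_map_lipschitz_on_balls der cont unfolding C1_map_def by blast
  define C where "C = exp ((2 * L + 1) * b)"
  have C: "1 \<le> C" using L0 b by (simp add: C_def)
  have C2: "C \<le> C\<^sup>2" using mult_left_mono[of 1 C C] C by (simp add: power2_eq_square)
  \<comment> \<open>With \<open>\<eta> = \<kappa> C \<bar>v\<bar>\<close>, this choice makes the Gronwall bound \<open>\<eta>\<^sup>2 b C\<close> at most \<open>(e \<bar>v\<bar>)\<^sup>2\<close>.\<close>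
  define \<kappa> where "\<kappa> = e / (C\<^sup>2 * (b + 1))"
  have \<kappa>: "0 < \<kappa>" using e C b by (simp add: \<kappa>_def)
  have "uniformly_continuous_on (cball 0 R) F'"
    by (intro compact_uniformly_continuous continuous_on_subset[OF cont]) auto
  then obtain d' where d': "d' > 0" "\<And>z z'. z \<in> cball 0 R \<Longrightarrow> z' \<in> cball 0 R \<Longrightarrow>
      dist z' z < d' \<Longrightarrow> dist (F' z') (F' z) < \<kappa>"
    using \<kappa> unfolding uniformly_continuous_on_def by metis
  define \<delta> where "\<delta> = min d' 1"
  have \<delta>: "0 < \<delta>" "\<delta> \<le> d'" "\<delta> \<le> 1" using d' by (auto simp: \<delta>_def)
  show "\<exists>d>0. \<forall>x. norm (x - u 0) < d \<longrightarrow>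
          norm (\<psi> b x - \<psi> b (u 0) - Y b (x - u 0)) \<le> e * norm (x - u 0)"
  proof (intro exI[of _ "\<delta> / C"] conjI allI impI)
    show "0 < \<delta> / C" using \<delta> C by simp
    fix x assume x: "norm (x - u 0) < \<delta> / C"
    define v where "v = x - u 0"
    define w where "w t = \<psi> t x" for t
    have w: "(w has_vector_derivative F (w t)) (at t)" for t
      unfolding w_def by (rule flow_ofD[OF flow])
    have w0: "w 0 - u 0 = v" by (simp add: w_def v_def flow_ofD[OF flow])
    have "norm v * C < \<delta>" using x C by (simp add: v_def field_simps)
    then have "(norm v * C)\<^sup>2 < \<delta>\<^sup>2" using C by (intro power_strict_mono) auto
    moreover have le: "(norm v)\<^sup>2 * C \<le> (norm v * C)\<^sup>2"
      using C2 by (simp add: power_mult_distrib mult_left_mono)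
    ultimately have small: "((norm (w 0 - u 0))\<^sup>2 + 0\<^sup>2 * b) * exp ((2 * L + 1) * b) < \<delta>\<^sup>2"
      by (simp add: w0 C_def)
    have inside: "norm (u t) + \<delta> \<le> R" if "0 \<le> t" "t \<le> b" for t
      using B[OF that] \<delta> by (simp add: R_def)
    have near: "norm (w t - u t) < \<delta>" "norm (w t - u t) \<le> C * norm v"
      if t: "0 \<le> t" "t \<le> b" for t
    proof -
      show "norm (w t - u t) < \<delta>"
        by (rule solution_comparison(2)[OF lip u w inside _ small \<delta>(1) t]) auto
      have "(norm (w t - u t))\<^sup>2 \<le> ((norm (w 0 - u 0))\<^sup>2 + 0\<^sup>2 * t) * exp ((2 * L + 1) * t)"
        by (rule solution_comparison(1)[OF lip u w inside _ small \<delta>(1) t]) auto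
      also have "\<dots> \<le> (norm v)\<^sup>2 * C"
        using t L0 by (simp add: w0 C_def mult_left_mono)
      also note le
      finally show "norm (w t - u t) \<le> C * norm v"
        using C power2_le_imp_le[of "norm (w t - u t)" "norm v * C"] by (simp add: mult.commute)
    qed
    define r where "r t = w t - u t - Y t v" for t
    have r: "(r has_vector_derivative F (w t) - F (u t) - F' (u t) (Y t v)) (at t)" for t
      unfolding r_def by (intro has_vector_derivative_diff u w Y)
    have "(norm (r b))\<^sup>2 \<le> ((norm (r 0))\<^sup>2 + (\<kappa> * (C * norm v))\<^sup>2 * b) * exp ((2 * L + 1) * b)"
    proof (rule gronwall_square[OF r _ b L0])
      fix t assume t: "0 \<le> t" "t \<le> b"
      define S where "S = cball 0 R \<inter> ball (u t) d'"
      have us: "u t \<in> S" using inside[OF t] \<delta> d'(1) by (simp add: S_def)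
      have "norm (w t) \<le> norm (u t) + norm (w t - u t)" by (rule norm_triangle_sub)
      then have ws: "w t \<in> S"
        using inside[OF t] near(1)[OF t] \<delta> by (simp add: S_def dist_norm norm_minus_commute)
      have "convex S" unfolding S_def by (intro convex_Int) auto
      have seg: "u t + s *\<^sub>R (w t - u t) \<in> S" if "s \<in> {0..1}" for s
        using convexD_alt[OF \<open>convex S\<close> us ws, of s] that by (simp add: algebra_simps)
      have "norm (F (w t) - F (u t) - F' (u t) (w t - u t)) \<le> norm (w t - u t) * \<kappa>"
      proof (rule differentiable_bound_linearization[where S=S and f'="\<lambda>z. blinfun_apply (F' z)"])
        show "u t + s *\<^sub>R (w t - u t) \<in> S" if "s \<in> {0..1}" for s using seg that .
        show "(F has_derivative blinfun_apply (F' z)) (at z within S)" for z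
          using der by (rule has_derivative_at_withinI)
        show "onorm (blinfun_apply (F' z) - blinfun_apply (F' (u t))) \<le> \<kappa>" if "z \<in> S" for z
        proof -
          have "norm (F' z - F' (u t)) < \<kappa>"
            using d'(2)[of "u t" z] that us by (simp add: S_def dist_norm norm_minus_commute)
          then show ?thesis by (simp add: norm_blinfun.rep_eq minus_blinfun.rep_eq fun_diff_def)
        qed
        show "u t \<in> S" by fact
      qed
      also have "\<dots> \<le> \<kappa> * (C * norm v)"
        using near(2)[OF t] \<kappa> by (simp add: mult.commute mult_left_mono)
      finally have 1: "norm (F (w t) - F (u t) - F' (u t) (w t - u t)) \<le> \<kappa> * (C * norm v)" .
      have "norm (F' (u t) (r t)) \<le> norm (F' (u t)) * norm (r t)" by (rule norm_blinfun)
      also have "\<dots> \<le> L * norm (r t)" using L us by (intro mult_right_mono) (auto simp: S_def)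
      finally have 2: "norm (F' (u t) (r t)) \<le> L * norm (r t)" .
      have "F (w t) - F (u t) - F' (u t) (Y t v)
          = (F (w t) - F (u t) - F' (u t) (w t - u t)) + F' (u t) (r t)"
        by (simp add: r_def blinfun.diff_right)
      then show "norm (F (w t) - F (u t) - F' (u t) (Y t v)) \<le> L * norm (r t) + \<kappa> * (C * norm v)"
        using 1 2 norm_triangle_le by (smt (verit))
    qed
    also have "\<dots> = (e * norm v)\<^sup>2 * (b / (C * (b + 1)\<^sup>2))"
    proof -
      have "\<kappa> * (C * norm v) = e * norm v / (C * (b + 1))"
        using C by (simp add: \<kappa>_def power2_eq_square)
      then show ?thesis
        unfolding C_def[symmetric] using C
        by (simp add: r_def w0 Y0 power_divide power_mult_distrib power2_eq_square[of C])
    qed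
    also have "\<dots> \<le> (e * norm v)\<^sup>2 * 1"
    proof (rule mult_left_mono)
      have "b \<le> (b + 1)\<^sup>2" using b by (simp add: power2_eq_square algebra_simps)
      also have "\<dots> \<le> C * (b + 1)\<^sup>2" using C mult_right_mono[of 1 C "(b+1)\<^sup>2"] by simp
      finally show "b / (C * (b + 1)\<^sup>2) \<le> 1" using C b by (simp add: divide_le_eq_1)
    qed simp
    finally have "(norm (r b))\<^sup>2 \<le> (e * norm v)\<^sup>2" by simp
    then have "norm (r b) \<le> e * norm v" by (rule power2_le_imp_le) (use e in simp)
    then show "norm (\<psi> b x - \<psi> b (u 0) - Y b (x - u 0)) \<le> e * norm (x - u 0)"
      using flow_of_solution[OF lipF flow u, of b 0] by (simp add: r_def w_def v_def)
  qed
qed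

section \<open>Attraction by a hyperbolic planar orbit\<close>

text \<open>
  The eigenvalues of \<open>M\<close> are \<open>1\<close> and \<open>\<mu> = tr M - 1\<close>, the latter real. By Cayley-Hamilton
  \<open>(M - 1) (M - \<mu>) = 0\<close>, and the eigenspace of \<open>1\<close> is spanned by \<open>h\<close>, so \<open>(M - \<mu>) v\<close> is a multiple
  of \<open>h\<close>; dividing it by \<open>1 - \<mu>\<close> gives the component \<open>a h\<close> of \<open>v\<close>.
\<close>

lemma hyperbolic_splitting:
  fixes M :: "real^2^2"
  assumes h: "h \<noteq> 0" "M *v h = h"
    and simple: "order 1 (complex_charpoly M) = 1"
    and circle: "\<And>\<mu>. poly (complex_charpoly M) \<mu> = 0 \<Longrightarrow> cmod \<mu> = 1 \<Longrightarrow> \<mu> = 1"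
  obtains \<mu> C where "\<bar>\<mu>\<bar> \<noteq> 1" "0 \<le> C"
    "\<And>v. \<exists>a. \<bar>a\<bar> \<le> C * norm v \<and> M *v (v - a *\<^sub>R h) = \<mu> *\<^sub>R (v - a *\<^sub>R h)"
proof -
  define \<mu> where "\<mu> = M$1$1 + M$2$2 - 1"
  define p where "p = complex_charpoly M"
  have p: "p = [:complex_of_real (M$1$1 * M$2$2 - M$1$2 * M$2$1), - complex_of_real (M$1$1 + M$2$2), 1:]"
    unfolding p_def complex_charpoly_def det_2 by (simp add: mat_def algebra_simps)
  have "poly p 1 = 0" using simple by (simp add: order_root p_def)
  then have "complex_of_real (1 + M$1$1 * M$2$2 - M$1$2 * M$2$1 - M$1$1 - M$2$2) = 0"
    by (simp add: p algebra_simps)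
  then have det: "M$1$1 * M$2$2 - M$1$2 * M$2$1 = \<mu>"
    unfolding of_real_eq_0_iff \<mu>_def by simp
  have fac: "p = [:-1, 1:] * [:- complex_of_real \<mu>, 1:]"
    unfolding p det by (simp add: \<mu>_def)
  have "\<mu> \<noteq> 1"
  proof
    assume "\<mu> = 1"
    then have "[:-1, 1:] ^ 2 dvd p" unfolding fac by (simp add: power2_eq_square)
    moreover have "p \<noteq> 0" unfolding p by simp
    ultimately show False using simple order_divides[of 1 2 p] by (simp add: p_def)
  qed
  moreover have "poly p (complex_of_real \<mu>) = 0" unfolding fac by simp
  ultimately have abs: "\<bar>\<mu>\<bar> \<noteq> 1"
    using circle[of "complex_of_real \<mu>"] by (auto simp: p_def)
  have h1: "M$1$1 * h$1 + M$1$2 * h$2 = h$1" and h2: "M$2$1 * h$1 + M$2$2 * h$2 = h$2"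
    using h(2) by (simp_all add: vec_eq_iff forall_2 matrix_vector_mult_def sum_2)
  define A where "A v = ((M *v v - \<mu> *\<^sub>R v) \<bullet> h) / ((1 - \<mu>) * (h \<bullet> h))" for v
  have "bounded_linear A"
    unfolding A_def
    by (intro bounded_linear_divide bounded_linear_inner_left bounded_linear_sub
        bounded_linear_compose[OF bounded_linear_inner_left] bounded_linear_compose[OF bounded_linear_divide]
        bounded_linear_scaleR_right matrix_vector_mul_bounded_linear)
  then obtain C where C: "0 \<le> C" "\<And>v. \<bar>A v\<bar> \<le> C * norm v"
    using bounded_linear.nonneg_bounded[of A] by (auto simp: mult.commute)
  have "M *v v - \<mu> *\<^sub>R v = ((1 - \<mu>) * A v) *\<^sub>R h" for v
  proof -
    define u where "u = M *v v - \<mu> *\<^sub>R v"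
    have u1: "u$1 = (1 - M$2$2) * v$1 + M$1$2 * v$2" and u2: "u$2 = M$2$1 * v$1 + (1 - M$1$1) * v$2"
      by (simp_all add: u_def matrix_vector_mult_def sum_2 \<mu>_def algebra_simps)
    \<comment> \<open>Both columns of \<open>M - \<mu>\<close> are parallel to \<open>h\<close>.\<close>
    have par: "u$1 * h$2 = u$2 * h$1"
    proof -
      have "u$1 * h$2 - u$2 * h$1
          = v$1 * (h$2 - (M$2$1 * h$1 + M$2$2 * h$2)) + v$2 * (M$1$1 * h$1 + M$1$2 * h$2 - h$1)"
        unfolding u1 u2 by (simp add: algebra_simps)
      then show ?thesis unfolding h1 h2 by simp
    qed
    have hh: "h \<bullet> h \<noteq> 0" using h by simp
    have uh: "u \<bullet> h = u$1 * h$1 + u$2 * h$2" "h \<bullet> h = h$1 * h$1 + h$2 * h$2"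
      by (simp_all add: inner_vec_def sum_2)
    have "(h \<bullet> h) * u$1 = (u \<bullet> h) * h$1" "(h \<bullet> h) * u$2 = (u \<bullet> h) * h$2"
      unfolding uh using par by algebra+
    then have "(h \<bullet> h) *\<^sub>R u = (u \<bullet> h) *\<^sub>R h" by (simp add: vec_eq_iff forall_2)
    then have "u = ((u \<bullet> h) / (h \<bullet> h)) *\<^sub>R h"
      using hh by (metis (no_types, lifting) divide_inverse mult.commute scaleR_scaleR scaleR_one
          left_inverse)
    moreover have "(u \<bullet> h) / (h \<bullet> h) = (1 - \<mu>) * A v"
      using \<open>\<mu> \<noteq> 1\<close> hh by (simp add: A_def u_def)
    ultimately show ?thesis unfolding u_def by metis
  qed
  then have "M *v (v - A v *\<^sub>R h) = \<mu> *\<^sub>R (v - A v *\<^sub>R h)" for v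
    using h(2) by (simp add: matrix_vector_mult_diff_distrib matrix_vector_mult_scaleR algebra_simps
        eq_diff_eq diff_eq_eq)
  then show thesis using that[OF abs C(1)] C(2) by blast
qed

text \<open>
  Write \<open>v = x - p\<close> as \<open>a h\<close> plus an eigenvector of \<open>\<mu>\<close>. To first order \<open>P\<^sup>k x\<close> is
  \<open>p + a h + \<mu>\<^sup>k (v - a h)\<close>. The first two terms agree to first order with \<open>\<gamma> a\<close>, and the last
  one is small for large \<open>k\<close>.
\<close>

lemma contraction_at_fixed_point:
  fixes P :: "'a::real_normed_vector \<Rightarrow> 'a"
  assumes P: "(P has_derivative L) (at p)" "P p = p"
    and \<gamma>: "(\<gamma> has_vector_derivative h) (at 0)" "\<gamma> 0 = p"
    and Lh: "L h = h"
    and split: "\<And>v. \<exists>a. \<bar>a\<bar> \<le> C * norm v \<and> L (v - a *\<^sub>R h) = \<mu> *\<^sub>R (v - a *\<^sub>R h)"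
    and C: "0 \<le> C" and \<mu>: "\<bar>\<mu>\<bar> < 1" and q: "0 < q"
  shows "\<exists>k. \<exists>\<delta>>0. \<forall>x. dist x p < \<delta> \<longrightarrow> infdist ((P ^^ k) x) (range \<gamma>) \<le> q * dist x p"
proof -
  have "linear L" using P(1) has_derivative_linear by blast
  define K where "K = 1 + C * norm h"
  have K: "0 < K" using C by (simp add: K_def add_pos_nonneg)
  obtain k where "\<bar>\<mu>\<bar> ^ k < q / (2 * K)"
    using real_arch_pow_inv[of "q / (2 * K)" "\<bar>\<mu>\<bar>"] q K \<mu> by auto
  then have k: "\<bar>\<mu>\<bar> ^ k * K \<le> q / 2" using K by (simp add: field_simps)
  have Pk: "((P ^^ j) has_derivative (L ^^ j)) (at p) \<and> (P ^^ j) p = p" for j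
  proof (induction j)
    case 0
    then show ?case by (simp add: id_def)
  next
    case (Suc j)
    then show ?case using diff_chain_at[of "P ^^ j" "L ^^ j" p P L] P by (simp add: o_def)
  qed
  have Lw: "(L ^^ j) w = \<mu> ^ j *\<^sub>R w" if "L w = \<mu> *\<^sub>R w" for w j
    by (induction j) (simp_all add: linear_cmul[OF \<open>linear L\<close>] that)
  have Lkh: "(L ^^ j) h = h" for j by (induction j) (simp_all add: Lh)
  have "linear (L ^^ k)" using Pk has_derivative_linear by blast
  obtain d1 where d1: "d1 > 0"
    "\<And>x. norm (x - p) < d1 \<Longrightarrow> norm ((P ^^ k) x - p - (L ^^ k) (x - p)) \<le> q / 4 * norm (x - p)"
    using Pk[of k] q unfolding has_derivative_at_alt by (metis divide_pos_pos zero_less_numeral)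
  define \<kappa> where "\<kappa> = q / 4 / (C + 1)"
  have "\<kappa> > 0" using q C by (simp add: \<kappa>_def)
  then obtain d2 where d2: "d2 > 0" "\<And>a. \<bar>a\<bar> < d2 \<Longrightarrow> norm (\<gamma> a - p - a *\<^sub>R h) \<le> \<kappa> * \<bar>a\<bar>"
    using \<gamma> unfolding has_vector_derivative_def has_derivative_at_alt by auto
  show ?thesis
  proof (intro exI[of _ k] exI[of _ "min d1 (d2 / (C + 1))"] conjI allI impI)
    show "0 < min d1 (d2 / (C + 1))" using d1 d2 C by simp
    fix x assume x: "dist x p < min d1 (d2 / (C + 1))"
    define v where "v = x - p"
    have v: "norm v < d1" "(C + 1) * norm v < d2"
      using x C by (auto simp: v_def dist_norm field_simps)
    obtain a where a: "\<bar>a\<bar> \<le> C * norm v" "L (v - a *\<^sub>R h) = \<mu> *\<^sub>R (v - a *\<^sub>R h)"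
      using split by blast
    have "\<bar>a\<bar> < d2" using a(1) v(2) norm_ge_zero[of v] unfolding distrib_right by linarith
    then have "norm (\<gamma> a - p - a *\<^sub>R h) \<le> \<kappa> * \<bar>a\<bar>" by (rule d2)
    also have "\<dots> \<le> \<kappa> * ((C + 1) * norm v)"
    proof (rule mult_left_mono)
      show "\<bar>a\<bar> \<le> (C + 1) * norm v"
        using a(1) norm_ge_zero[of v] unfolding distrib_right by linarith
    qed (use \<open>\<kappa> > 0\<close> in simp)
    also have "\<dots> = q / 4 * norm v"
    proof -
      have "C + 1 \<noteq> 0" using C by simp
      then have "\<kappa> * (C + 1) = q / 4" unfolding \<kappa>_def by (metis nonzero_eq_divide_eq)
      then show ?thesis by (metis mult.assoc)
    qed
    finally have 1: "norm (\<gamma> a - p - a *\<^sub>R h) \<le> q / 4 * norm v" .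
    have 2: "norm ((P ^^ k) x - p - (L ^^ k) v) \<le> q / 4 * norm v"
      using d1(2) v(1) by (simp add: v_def)
    have "(L ^^ k) v - a *\<^sub>R h = (L ^^ k) (v - a *\<^sub>R h)"
      by (simp add: linear_diff[OF \<open>linear (L ^^ k)\<close>] linear_cmul[OF \<open>linear (L ^^ k)\<close>] Lkh)
    then have "norm ((L ^^ k) v - a *\<^sub>R h) = \<bar>\<mu>\<bar> ^ k * norm (v - a *\<^sub>R h)"
      using Lw[OF a(2)] by (simp add: power_abs)
    also have "\<dots> \<le> \<bar>\<mu>\<bar> ^ k * (K * norm v)"
    proof (rule mult_left_mono)
      have "norm (v - a *\<^sub>R h) \<le> norm v + \<bar>a\<bar> * norm h"
        using norm_triangle_ineq4[of v "a *\<^sub>R h"] by simp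
      also have "\<bar>a\<bar> * norm h \<le> C * norm v * norm h" by (intro mult_right_mono a) simp
      finally show "norm (v - a *\<^sub>R h) \<le> K * norm v" by (simp add: K_def algebra_simps)
    qed simp
    also have "\<dots> \<le> q / 2 * norm v"
      using mult_right_mono[OF k norm_ge_zero[of v]] by (simp add: mult.assoc)
    finally have 3: "norm ((L ^^ k) v - a *\<^sub>R h) \<le> q / 2 * norm v" .
    have "(P ^^ k) x - \<gamma> a
        = ((P ^^ k) x - p - (L ^^ k) v) + ((L ^^ k) v - a *\<^sub>R h) - (\<gamma> a - p - a *\<^sub>R h)"
      by simp
    also have "norm \<dots> \<le> norm ((P ^^ k) x - p - (L ^^ k) v) + norm ((L ^^ k) v - a *\<^sub>R h)
        + norm (\<gamma> a - p - a *\<^sub>R h)"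
      by (meson norm_triangle_ineq norm_triangle_ineq4 add_right_mono order_trans)
    finally have "dist ((P ^^ k) x) (\<gamma> a) \<le> q * norm v"
      using 1 2 3 by (simp add: dist_norm)
    then show "infdist ((P ^^ k) x) (range \<gamma>) \<le> q * dist x p"
      using infdist_le[of "\<gamma> a" "range \<gamma>" "(P ^^ k) x"] by (simp add: v_def dist_norm)
  qed
qed

text \<open>
  The constants do not depend on the starting time \<open>s\<close> on the reference solution: this uniformity
  is what extends estimates at one point of an orbit to the whole orbit.
\<close>

lemma flow_near_bounded_solution:
  fixes F :: "'a::real_inner \<Rightarrow> 'a"
  assumes lip: "lipschitz_on_balls F" and flow: "flow_of F \<psi>"
    and \<gamma>: "\<And>t. (\<gamma> has_vector_derivative F (\<gamma> t)) (at t)"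
    and B: "\<And>t. norm (\<gamma> t) \<le> B" and b: "0 \<le> b"
  obtains \<Lambda> \<delta> where "1 \<le> \<Lambda>" "0 < \<delta>"
    "\<And>s t x. 0 \<le> t \<Longrightarrow> t \<le> b \<Longrightarrow> norm (x - \<gamma> s) < \<delta> \<Longrightarrow>
       norm (\<psi> t x - \<gamma> (s + t)) \<le> \<Lambda> * norm (x - \<gamma> s)"
proof -
  obtain L where L: "L-lipschitz_on (cball 0 (B + 1)) F"
    using lip unfolding lipschitz_on_balls_def by blast
  have L0: "0 \<le> L" using L by (rule lipschitz_on_nonneg)
  define \<Lambda> where "\<Lambda> = exp ((2 * L + 1) * b)"
  have \<Lambda>: "1 \<le> \<Lambda>" using L0 b by (simp add: \<Lambda>_def)
  have \<Lambda>2: "\<Lambda> \<le> \<Lambda>\<^sup>2" using mult_left_mono[of 1 \<Lambda> \<Lambda>] \<Lambda> by (simp add: power2_eq_square)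
  show thesis
  proof
    show "1 \<le> \<Lambda>" by fact
    show "0 < 1 / \<Lambda>" using \<Lambda> by simp
    fix s t x assume t: "0 \<le> t" "t \<le> b" and x: "norm (x - \<gamma> s) < 1 / \<Lambda>"
    define d where "d = norm (x - \<gamma> s)"
    have "d * \<Lambda> < 1" using x \<Lambda> by (simp add: d_def field_simps)
    then have "(d * \<Lambda>)\<^sup>2 < 1" using \<Lambda> by (simp add: power_less_one_iff abs_square_less_1 d_def)
    moreover have le: "d\<^sup>2 * \<Lambda> \<le> (d * \<Lambda>)\<^sup>2"
      using \<Lambda>2 by (simp add: power_mult_distrib mult_left_mono)
    ultimately have small: "d\<^sup>2 * \<Lambda> < 1" by simp
    have "(norm (\<psi> t x - \<gamma> (s + t)))\<^sup>2
        \<le> ((norm (\<psi> 0 x - \<gamma> (s + 0)))\<^sup>2 + 0\<^sup>2 * t) * exp ((2 * L + 1) * t)"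
    proof (rule solution_comparison(1)[OF L, where G = F and b = b and \<delta> = 1])
      show "((norm (\<psi> 0 x - \<gamma> (s + 0)))\<^sup>2 + 0\<^sup>2 * b) * exp ((2 * L + 1) * b) < 1\<^sup>2"
        using small by (simp add: flow_ofD[OF flow] d_def \<Lambda>_def)
    qed (use B t in \<open>auto intro: flow_ofD[OF flow] shifted_solution[of \<gamma> F, OF \<gamma>]\<close>)
    also have "\<dots> \<le> d\<^sup>2 * \<Lambda>"
      using t L0 by (simp add: flow_ofD[OF flow] d_def \<Lambda>_def mult_left_mono)
    also note le
    finally show "norm (\<psi> t x - \<gamma> (s + t)) \<le> \<Lambda> * norm (x - \<gamma> s)"
      using \<Lambda> power2_le_imp_le[of "norm (\<psi> t x - \<gamma> (s + t))" "d * \<Lambda>"]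
      by (simp add: mult.commute d_def)
  qed
qed

lemma periodic_range:
  fixes \<gamma> :: "real \<Rightarrow> 'a"
  assumes per: "\<And>t. \<gamma> (t + T) = \<gamma> t" and T: "0 < T"
  shows "range \<gamma> = \<gamma> ` {0..T}"
proof -
  have nat: "\<gamma> (t + real n * T) = \<gamma> t" for t n
  proof (induction n)
    case (Suc n)
    then show ?case using per[of "t + real n * T"] by (simp add: algebra_simps)
  qed simp
  have int: "\<gamma> (t + of_int n * T) = \<gamma> t" for t n
    using nat[of t "nat n"] nat[of "t + of_int n * T" "nat (- n)"] by (cases "0 \<le> n") auto
  have "\<gamma> t \<in> \<gamma> ` {0..T}" for t
  proof
    show "\<gamma> t = \<gamma> (t + of_int (- \<lfloor>t / T\<rfloor>) * T)" by (simp only: int)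
    have "of_int \<lfloor>t / T\<rfloor> * T \<le> t"
      using of_int_floor_le[of "t / T"] unfolding pos_le_divide_eq[OF T] .
    moreover have "t < (of_int \<lfloor>t / T\<rfloor> + 1) * T"
      using real_of_int_floor_add_one_gt[of "t / T"] unfolding pos_divide_less_eq[OF T] .
    ultimately show "t + of_int (- \<lfloor>t / T\<rfloor>) * T \<in> {0..T}" by (simp add: algebra_simps)
  qed
  then show ?thesis by blast
qed

lemma periodic_solution_compact:
  fixes \<gamma> :: "real \<Rightarrow> 'a::real_normed_vector"
  assumes "\<And>t. (\<gamma> has_vector_derivative F (\<gamma> t)) (at t)" "\<And>t. \<gamma> (t + T) = \<gamma> t" "0 < T"
  shows "compact (range \<gamma>)"
  unfolding periodic_range[of \<gamma>, OF assms(2,3)]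
  using assms(1)
  by (intro compact_continuous_image)
     (meson continuous_at_imp_continuous_on has_vector_derivative_continuous, simp)

text \<open>
  A point near \<open>\<gamma> s\<close> is carried by the flow to the neighbourhood of \<open>\<gamma> 0\<close> in time \<open>T - s\<close>,
  contracted there during \<open>k\<close> periods, and carried on for time \<open>s\<close>. The total time
  \<open>(k + 1) T\<close> is the same for all points. The two transports expand distances by at most \<open>\<Lambda>\<close>
  each, which the contraction factor \<open>1 / (2 \<Lambda>\<^sup>2)\<close> compensates.
\<close>

lemma orbit_contraction:
  fixes F :: "'a::euclidean_space \<Rightarrow> 'a"
  assumes lip: "lipschitz_on_balls F" and flow: "flow_of F \<psi>"
    and \<gamma>: "\<And>t. (\<gamma> has_vector_derivative F (\<gamma> t)) (at t)"
    and per: "\<And>t. \<gamma> (t + T) = \<gamma> t" and T: "0 < T"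
    and contr: "\<And>q. 0 < q \<Longrightarrow> \<exists>k. \<exists>\<delta>>0. \<forall>x. dist x (\<gamma> 0) < \<delta> \<longrightarrow>
        infdist ((\<psi> T ^^ k) x) (range \<gamma>) \<le> q * dist x (\<gamma> 0)"
  obtains n :: nat and \<rho> where "1 \<le> n" "0 < \<rho>"
    "\<And>x. infdist x (range \<gamma>) \<le> \<rho> \<Longrightarrow>
        infdist (\<psi> (real n * T) x) (range \<gamma>) \<le> infdist x (range \<gamma>) / 2"
proof -
  have cpt: "compact (range \<gamma>)" by (rule periodic_solution_compact[of \<gamma> F, OF \<gamma> per T])
  then obtain B where B: "\<And>t. norm (\<gamma> t) \<le> B"
    using compact_imp_bounded bounded_iff by (metis rangeI)
  obtain \<Lambda> \<delta> where \<Lambda>: "1 \<le> \<Lambda>" and \<delta>: "0 < \<delta>" and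
    near: "\<And>s t x. 0 \<le> t \<Longrightarrow> t \<le> T \<Longrightarrow> norm (x - \<gamma> s) < \<delta> \<Longrightarrow>
       norm (\<psi> t x - \<gamma> (s + t)) \<le> \<Lambda> * norm (x - \<gamma> s)"
    using flow_near_bounded_solution[of F \<psi> \<gamma>, OF lip flow \<gamma> B less_imp_le[OF T]] by blast
  define q where "q = 1 / (2 * \<Lambda>\<^sup>2)"
  have "0 < q" using \<Lambda> by (simp add: q_def)
  then obtain k \<delta>2 where \<delta>2: "0 < \<delta>2" and k: "\<And>x. dist x (\<gamma> 0) < \<delta>2 \<Longrightarrow>
        infdist ((\<psi> T ^^ k) x) (range \<gamma>) \<le> q * dist x (\<gamma> 0)"
    using contr by blast
  have iter: "(\<psi> T ^^ j) x = \<psi> (real j * T) x" for j x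
    by (induction j) (simp_all add: flow_ofD[OF flow] flow_of_add[OF lip flow] algebra_simps)
  show thesis
  proof
    show "1 \<le> Suc k" by simp
    show "0 < min (\<delta> / 2) (\<delta>2 / (2 * \<Lambda>))" using \<delta> \<delta>2 \<Lambda> by simp
    fix x assume x: "infdist x (range \<gamma>) \<le> min (\<delta> / 2) (\<delta>2 / (2 * \<Lambda>))"
    define \<rho> where "\<rho> = infdist x (range \<gamma>)"
    have "0 \<le> \<rho>" by (simp add: \<rho>_def infdist_nonneg)
    have "\<rho> \<le> \<delta> / 2" "\<rho> \<le> \<delta>2 / (2 * \<Lambda>)" using x by (simp_all add: \<rho>_def)
    then have \<rho>: "\<rho> < \<delta>" "\<Lambda> * \<rho> < \<delta>2"
      using \<delta> \<delta>2 \<Lambda> by (auto simp: field_simps)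
    have attained: "\<exists>s. infdist z (range \<gamma>) = dist z (\<gamma> s)" for z
      using infdist_attains_inf[of "range \<gamma>" z] compact_imp_closed[OF cpt] by blast
    obtain s where s: "0 \<le> s" "s \<le> T" "norm (x - \<gamma> s) = \<rho>"
    proof -
      obtain s' where s': "\<rho> = dist x (\<gamma> s')" using attained \<rho>_def by blast
      obtain s where "\<gamma> s' = \<gamma> s" "s \<in> {0..T}"
        using periodic_range[of \<gamma>, OF per T] by (metis imageE rangeI)
      then show thesis using that s' by (auto simp: dist_norm)
    qed
    define x1 where "x1 = \<psi> (T - s) x"
    have "norm (x1 - \<gamma> (s + (T - s))) \<le> \<Lambda> * norm (x - \<gamma> s)"
      unfolding x1_def using s \<rho> by (intro near) auto
    then have x1: "dist x1 (\<gamma> 0) \<le> \<Lambda> * \<rho>"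
      using per[of 0] s by (simp add: dist_norm)
    define x2 where "x2 = \<psi> (real k * T) x1"
    have "infdist x2 (range \<gamma>) \<le> q * dist x1 (\<gamma> 0)"
      using k[of x1] x1 \<rho> by (simp add: x2_def iter)
    also have "\<dots> \<le> q * (\<Lambda> * \<rho>)" using x1 \<open>0 < q\<close> by simp
    also have "\<dots> = \<rho> / (2 * \<Lambda>)" using \<Lambda> by (simp add: q_def power2_eq_square)
    finally obtain s' where s': "norm (x2 - \<gamma> s') \<le> \<rho> / (2 * \<Lambda>)"
      using attained by (metis dist_norm)
    have "\<rho> / (2 * \<Lambda>) \<le> \<rho> / 1"
      using \<Lambda> \<open>0 \<le> \<rho>\<close> by (intro divide_left_mono) auto
    then have "norm (\<psi> s x2 - \<gamma> (s' + s)) \<le> \<Lambda> * norm (x2 - \<gamma> s')"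
      using s s' \<rho> by (intro near) auto
    also have "\<dots> \<le> \<Lambda> * (\<rho> / (2 * \<Lambda>))" using s' \<Lambda> by (intro mult_left_mono) auto
    also have "\<dots> = \<rho> / 2" using \<Lambda> by simp
    finally have "infdist (\<psi> s x2) (range \<gamma>) \<le> \<rho> / 2"
      using infdist_le[of "\<gamma> (s' + s)" "range \<gamma>" "\<psi> s x2"] by (simp add: dist_norm)
    moreover have "\<psi> s x2 = \<psi> (real (Suc k) * T) x"
      by (simp add: x2_def x1_def flow_of_add[OF lip flow] algebra_simps)
    ultimately show "infdist (\<psi> (real (Suc k) * T) x) (range \<gamma>) \<le> infdist x (range \<gamma>) / 2"
      by (simp add: \<rho>_def)
  qed
qed

section \<open>The slow drift near an attracting orbit\<close>

lemma lipschitz_on_balls_isometry: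
  assumes "lipschitz_on_balls F" "linear A" "\<And>z. norm (A z) = norm z"
  shows "lipschitz_on_balls (\<lambda>z. F (A z))"
  unfolding lipschitz_on_balls_def
proof
  fix R
  obtain L where L: "L-lipschitz_on (cball 0 R) F"
    using assms(1) unfolding lipschitz_on_balls_def by blast
  have "dist (A z) (A z') = dist z z'" for z z'
    using assms(3)[of "z - z'"] linear_diff[OF assms(2)] by (simp add: dist_norm)
  then have "L-lipschitz_on (cball 0 R) (\<lambda>z. F (A z))"
    using lipschitz_onD[OF L] assms(3) lipschitz_on_nonneg[OF L]
    by (intro lipschitz_onI) (metis mem_cball_0, simp)
  then show "\<exists>L. L-lipschitz_on (cball 0 R) (\<lambda>z. F (A z))" by blast
qed

lemma lipschitz_on_balls_fast_slow_field:
  assumes "lipschitz_on_balls f" "lipschitz_on_balls g"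
  shows "lipschitz_on_balls (fast_slow_field f g \<epsilon>)"
  unfolding lipschitz_on_balls_def
proof
  fix R
  obtain L M where "L-lipschitz_on (cball 0 R) f" "M-lipschitz_on (cball 0 R) g"
    using assms unfolding lipschitz_on_balls_def by blast
  from lipschitz_on_Pair[OF this(1) lipschitz_on_cmult_real[OF this(2), of \<epsilon>]]
  show "\<exists>L. L-lipschitz_on (cball 0 R) (fast_slow_field f g \<epsilon>)"
    unfolding fast_slow_field_def[abs_def] by blast
qed

text \<open>
  The average of \<open>g\<close> along the orbit is encoded by an antiderivative \<open>J\<close> of \<open>t \<mapsto> g (\<gamma> t, 0)\<close> that
  grows by \<open>I\<close> in each period. This makes the drift over a whole number of periods independent of
  the phase at which it starts, and reduces its comparison with the slow variable to a monotonicity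
  argument.
\<close>

locale attracting_orbit_with_drift =
  fixes f :: "phase \<Rightarrow> real^2" and g :: "phase \<Rightarrow> real"
    and \<phi> :: "real \<Rightarrow> real \<Rightarrow> phase \<Rightarrow> phase"
    and \<psi> :: "real \<Rightarrow> real^2 \<Rightarrow> real^2" and \<gamma> :: "real \<Rightarrow> real^2"
    and T I \<rho>\<^sub>0 :: real and J :: "real \<Rightarrow> real" and n :: nat
  assumes lf: "lipschitz_on_balls f" and lg: "lipschitz_on_balls g"
    and flow: "\<And>\<epsilon>. \<epsilon> \<ge> 0 \<Longrightarrow> flow_of (fast_slow_field f g \<epsilon>) (\<phi> \<epsilon>)"
    and fast_flow: "flow_of (\<lambda>x. f (x, 0)) \<psi>"
    and orbit: "\<And>t. (\<gamma> has_vector_derivative f (\<gamma> t, 0)) (at t)"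
    and period: "\<And>t. \<gamma> (t + T) = \<gamma> t" "0 < T"
    and antiderivative: "\<And>t. (J has_real_derivative g (\<gamma> t, 0)) (at t)"
    and drift: "\<And>t. J (t + T) = J t + I" "0 < I"
    and contraction: "1 \<le> n" "0 < \<rho>\<^sub>0"
      "\<And>x. infdist x (range \<gamma>) \<le> \<rho>\<^sub>0 \<Longrightarrow>
        infdist (\<psi> (real n * T) x) (range \<gamma>) \<le> infdist x (range \<gamma>) / 2"
begin

text \<open>
  The full solution \<open>w\<close> is compared with the solution \<open>u\<close> of the fast subsystem at \<open>y = 0\<close> with
  the same fast coordinate, and \<open>u\<close> with the orbit \<open>\<gamma>\<close> itself. The first comparison, to accuracy
  \<open>\<kappa> \<le> \<rho> / 2\<close>, keeps the contracted tube inside the tube of radius \<open>\<rho>\<close>. Both together, to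
  accuracy \<open>2 \<sigma>\<close>, make \<open>g\<close> along \<open>w\<close> differ from \<open>g\<close> along \<open>\<gamma>\<close> by at most half of
  the mean \<open>m\<close>.
\<close>

lemma drift_step:
  obtains \<tau> \<rho> \<eta> c C where "0 < \<tau>" "0 < \<rho>" "0 < \<eta>" "0 < c" "0 < C"
    "\<And>\<epsilon> x y. 0 < \<epsilon> \<Longrightarrow> \<epsilon> \<le> \<eta> \<Longrightarrow> infdist x (range \<gamma>) \<le> \<rho> \<Longrightarrow> \<bar>y\<bar> \<le> \<eta> \<Longrightarrow>
       infdist (fst (\<phi> \<epsilon> \<tau> (x, y))) (range \<gamma>) \<le> \<rho> \<and>
       c * \<epsilon> \<le> snd (\<phi> \<epsilon> \<tau> (x, y)) - y \<and> snd (\<phi> \<epsilon> \<tau> (x, y)) - y \<le> C * \<epsilon>"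
proof -
  have cpt: "compact (range \<gamma>)"
    by (rule periodic_solution_compact[of \<gamma> "\<lambda>x. f (x, 0)", OF orbit period])
  then obtain B where B: "\<And>t. norm (\<gamma> t) \<le> B"
    using compact_imp_bounded bounded_iff by (metis rangeI)
  define R where "R = B + 2"
  have R: "0 \<le> R" using norm_ge_zero[of "\<gamma> 0"] B[of 0] unfolding R_def by linarith
  define \<tau> where "\<tau> = real n * T"
  have \<tau>: "0 < \<tau>" using contraction(1) period by (simp add: \<tau>_def)
  have "lipschitz_on_balls (\<lambda>x. f (x, 0))"
    by (rule lipschitz_on_balls_isometry[OF lf]) (auto simp: linear_iff norm_Pair)
  then obtain \<Lambda> \<delta> where \<Lambda>: "1 \<le> \<Lambda>" and \<delta>: "0 < \<delta>" and
    near: "\<And>s t x. 0 \<le> t \<Longrightarrow> t \<le> \<tau> \<Longrightarrow> norm (x - \<gamma> s) < \<delta> \<Longrightarrow>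
       norm (\<psi> t x - \<gamma> (s + t)) \<le> \<Lambda> * norm (x - \<gamma> s)"
    using flow_near_bounded_solution[of "\<lambda>x. f (x, 0)" \<psi> \<gamma>, OF _ fast_flow orbit B less_imp_le[OF \<tau>]]
    by blast
  obtain L where L: "L-lipschitz_on (cball 0 R) (fast_slow_field f g 0)"
    using lipschitz_on_balls_fast_slow_field[OF lf lg] unfolding lipschitz_on_balls_def by blast
  obtain M where M: "M-lipschitz_on (cball 0 R) g"
    using lg unfolding lipschitz_on_balls_def by blast
  have L0: "0 \<le> L" and M0: "0 \<le> M"
    using L M by (auto intro: lipschitz_on_nonneg)
  define G where "G = \<bar>g 0\<bar> + M * R + 1"
  have G: "0 < G" using M0 R by (simp add: G_def add_nonneg_pos)
  have g_le: "\<bar>g z\<bar> \<le> G" if "z \<in> cball 0 R" for z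
  proof -
    have "\<bar>g z - g 0\<bar> \<le> M * norm z"
      using lipschitz_onD[OF M that, of 0] R by (simp add: dist_norm)
    also have "\<dots> \<le> M * R" using that M0 by (intro mult_left_mono) auto
    finally show ?thesis unfolding G_def by linarith
  qed
  define m where "m = I / T"
  have m: "0 < m" using drift period by (simp add: m_def)
  have nI: "real n * I = \<tau> * m" using period by (simp add: \<tau>_def m_def)
  define \<sigma> where "\<sigma> = min (m / (2 * (M + 1))) 1 / 2"
  have \<sigma>: "0 < \<sigma>" "\<sigma> \<le> 1 / 2" using m M0 by (auto simp: \<sigma>_def)
  have M\<sigma>: "M * (2 * \<sigma>) \<le> m / 2"
  proof -
    have "M * (2 * \<sigma>) \<le> (M + 1) * (m / (2 * (M + 1)))"
      using M0 m \<sigma> by (intro mult_mono) (auto simp: \<sigma>_def)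
    also have "\<dots> = m / 2" using M0 by (simp add: field_simps)
    finally show ?thesis .
  qed
  define \<rho> where "\<rho> = min \<rho>\<^sub>0 (min (\<delta> / 2) (\<sigma> / \<Lambda>))"
  have \<rho>: "0 < \<rho>" "\<rho> \<le> \<rho>\<^sub>0" "\<rho> < \<delta>" "\<Lambda> * \<rho> \<le> \<sigma>"
  proof -
    show "0 < \<rho>" "\<rho> \<le> \<rho>\<^sub>0" "\<rho> < \<delta>" using contraction(2) \<delta> \<sigma> \<Lambda> by (auto simp: \<rho>_def)
    have "\<rho> \<le> \<sigma> / \<Lambda>" by (simp add: \<rho>_def)
    then show "\<Lambda> * \<rho> \<le> \<sigma>" using \<Lambda> by (simp add: field_simps)
  qed
  define \<kappa> where "\<kappa> = min \<sigma> (\<rho> / 2)"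
  have \<kappa>: "0 < \<kappa>" "\<kappa> \<le> \<sigma>" "\<kappa> \<le> \<rho> / 2" using \<sigma> \<rho> by (auto simp: \<kappa>_def)
  define E where "E = exp ((2 * L + 1) * \<tau>)"
  define A where "A = (1 + G\<^sup>2 * \<tau>) * E"
  have E: "1 \<le> E" using L0 \<tau> by (simp add: E_def)
  have A: "1 \<le> A"
    unfolding A_def using mult_mono[of 1 "1 + G\<^sup>2 * \<tau>" 1 E] E \<tau> by simp
  \<comment> \<open>The comparison bound for \<open>w - u\<close> is \<open>\<eta>\<^sup>2 A\<close> when \<open>\<bar>y\<bar> \<le> \<eta>\<close> and \<open>\<epsilon> \<le> \<eta>\<close>.\<close>
  define \<eta> where "\<eta> = \<kappa> / (2 * A)"
  have \<eta>: "0 < \<eta>" using \<kappa> A by (simp add: \<eta>_def)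
  have \<eta>A: "\<eta>\<^sup>2 * A < \<kappa>\<^sup>2"
  proof -
    have "\<eta>\<^sup>2 * A = \<kappa>\<^sup>2 / (4 * A)"
      using A by (simp add: \<eta>_def power_divide power_mult_distrib power2_eq_square[of A])
    also have "\<dots> < \<kappa>\<^sup>2 / 1" using A \<kappa> by (intro divide_strict_left_mono) auto
    finally show ?thesis by simp
  qed
  show thesis
  proof (rule that[of \<tau> \<rho> \<eta> "\<tau> * m / 2" "G * \<tau>"])
    show "0 < \<tau>" "0 < \<rho>" "0 < \<eta>" "0 < \<tau> * m / 2" "0 < G * \<tau>" using \<tau> \<rho> \<eta> m G by auto
    fix \<epsilon> y :: real and x :: "real^2"
    assume \<epsilon>: "0 < \<epsilon>" "\<epsilon> \<le> \<eta>" and x: "infdist x (range \<gamma>) \<le> \<rho>" and y: "\<bar>y\<bar> \<le> \<eta>"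
    obtain s where s: "infdist x (range \<gamma>) = norm (x - \<gamma> s)"
      using infdist_attains_inf[of "range \<gamma>" x] compact_imp_closed[OF cpt]
      by (auto simp: dist_norm)
    define u where "u t = (\<psi> t x, 0 :: real)" for t
    define w where "w t = \<phi> \<epsilon> t (x, y)" for t
    have u: "(u has_vector_derivative fast_slow_field f g 0 (u t)) (at t)" for t
      unfolding u_def fast_slow_field_def
      by (auto intro!: has_vector_derivative_Pair flow_ofD[OF fast_flow])
    have w: "(w has_vector_derivative fast_slow_field f g \<epsilon> (w t)) (at t)" for t
      unfolding w_def using flow_ofD[OF flow] \<epsilon> by simp
    have tube: "norm (\<psi> t x - \<gamma> (s + t)) \<le> \<sigma>" if "0 \<le> t" "t \<le> \<tau>" for t
    proof -
      have "norm (\<psi> t x - \<gamma> (s + t)) \<le> \<Lambda> * norm (x - \<gamma> s)"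
        using that x \<rho> s by (intro near) auto
      also have "\<dots> \<le> \<Lambda> * \<rho>" using x s \<Lambda> by (intro mult_left_mono) auto
      finally show ?thesis using \<rho> by simp
    qed
    have inside: "norm (u t) + \<kappa> \<le> R" if t: "0 \<le> t" "t \<le> \<tau>" for t
    proof -
      have "norm (u t) \<le> norm (\<gamma> (s + t)) + norm (\<psi> t x - \<gamma> (s + t))"
        using norm_triangle_sub[of "\<psi> t x" "\<gamma> (s + t)"] by (simp add: u_def norm_Pair)
      then show ?thesis using B[of "s + t"] tube[OF t] \<sigma> \<kappa> by (simp add: R_def)
    qed
    have close: "norm (w t - u t) < \<kappa>" if t: "0 \<le> t" "t \<le> \<tau>" for t
    proof (rule solution_comparison(2)[OF L u w inside _ _ \<kappa>(1) t, where \<eta> = "\<epsilon> * G"])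
      show "norm (fast_slow_field f g \<epsilon> z - fast_slow_field f g 0 z) \<le> \<epsilon> * G"
        if "z \<in> cball 0 R" for z
        using g_le[OF that] \<epsilon> by (simp add: fast_slow_field_def norm_Pair abs_mult)
      have "((norm (w 0 - u 0))\<^sup>2 + (\<epsilon> * G)\<^sup>2 * \<tau>) * E \<le> (\<eta>\<^sup>2 + (\<eta> * G)\<^sup>2 * \<tau>) * E"
      proof (intro mult_right_mono add_mono power_mono)
        show "norm (w 0 - u 0) \<le> \<eta>"
          using y \<epsilon> by (simp add: w_def u_def flow_ofD[OF flow] flow_ofD[OF fast_flow] norm_Pair)
      qed (use \<epsilon> G \<tau> E in auto)
      also have "\<dots> = \<eta>\<^sup>2 * A" by (simp add: A_def power_mult_distrib algebra_simps)
      also note \<eta>A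
      finally show "((norm (w 0 - u 0))\<^sup>2 + (\<epsilon> * G)\<^sup>2 * \<tau>) * exp ((2 * L + 1) * \<tau>) < \<kappa>\<^sup>2"
        by (simp add: E_def)
    qed
    have w_in: "w t \<in> cball 0 R" if t: "0 \<le> t" "t \<le> \<tau>" for t
      using norm_triangle_sub[of "w t" "u t"] close[OF t] inside[OF t] by simp
    have g_near: "\<bar>g (w t) - g (\<gamma> (s + t), 0)\<bar> \<le> m / 2" if t: "0 \<le> t" "t \<le> \<tau>" for t
    proof -
      have "(\<gamma> (s + t), 0 :: real) \<in> cball 0 R" using B[of "s + t"] by (simp add: norm_Pair R_def)
      then have "\<bar>g (w t) - g (\<gamma> (s + t), 0)\<bar> \<le> M * dist (w t) (\<gamma> (s + t), 0)"
        using lipschitz_onD[OF M w_in[OF t]] by (simp add: dist_norm)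
      also have "\<dots> \<le> M * (2 * \<sigma>)"
      proof (rule mult_left_mono[OF _ M0])
        have "dist (u t) (\<gamma> (s + t), 0) \<le> \<sigma>"
          using tube[OF t] by (simp add: u_def dist_Pair_Pair dist_norm)
        moreover have "dist (w t) (u t) < \<kappa>" using close[OF t] by (simp add: dist_norm)
        ultimately show "dist (w t) (\<gamma> (s + t), 0) \<le> 2 * \<sigma>"
          using dist_triangle[of "w t" "(\<gamma> (s + t), 0)" "u t"] \<kappa> by linarith
      qed
      finally show ?thesis using M\<sigma> by simp
    qed
    have slow: "((\<lambda>t. snd (w t)) has_real_derivative \<epsilon> * g (w t)) (at t)" for t
      using bounded_linear.has_vector_derivative[OF bounded_linear_snd w[of t]]
      by (simp add: fast_slow_field_def has_real_derivative_iff_has_vector_derivative)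
    have avg: "((\<lambda>t. J (s + t)) has_real_derivative g (\<gamma> (s + t), 0)) (at t)" for t
      using has_vector_derivative_affine[of J "g (\<gamma> (s + t), 0)" s 1 t] antiderivative
      by (simp add: has_real_derivative_iff_has_vector_derivative)
    have w0: "snd (w 0) = y" using \<epsilon> by (simp add: w_def flow_ofD[OF flow])
    have "snd (w 0) - \<epsilon> * J (s + 0) + \<epsilon> * m / 2 * 0
        \<le> snd (w \<tau>) - \<epsilon> * J (s + \<tau>) + \<epsilon> * m / 2 * \<tau>"
    proof (rule DERIV_nonneg_imp_nondecreasing[OF less_imp_le[OF \<tau>]])
      fix t assume t: "0 \<le> t" "t \<le> \<tau>"
      have "((\<lambda>t. snd (w t) - \<epsilon> * J (s + t) + \<epsilon> * m / 2 * t) has_real_derivative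
          \<epsilon> * g (w t) - \<epsilon> * g (\<gamma> (s + t), 0) + \<epsilon> * m / 2) (at t)"
        by (auto intro!: derivative_eq_intros slow avg)
      moreover have "0 \<le> \<epsilon> * (g (w t) - g (\<gamma> (s + t), 0) + m / 2)"
        using g_near[OF t] \<epsilon> by (intro mult_nonneg_nonneg) linarith+
      ultimately show "\<exists>d. ((\<lambda>t. snd (w t) - \<epsilon> * J (s + t) + \<epsilon> * m / 2 * t)
          has_real_derivative d) (at t) \<and> 0 \<le> d"
        by (intro exI conjI) (assumption, simp add: algebra_simps)
    qed
    moreover have "J (s + \<tau>) = J s + \<tau> * m"
    proof -
      have "J (s + real j * T) = J s + real j * I" for j
      proof (induction j)
        case (Suc j)
        then show ?case using drift(1)[of "s + real j * T"] by (simp add: algebra_simps)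
      qed simp
      then show ?thesis using nI by (simp add: \<tau>_def)
    qed
    ultimately have lower: "\<tau> * m / 2 * \<epsilon> \<le> snd (w \<tau>) - y"
      using w0 by (simp add: algebra_simps)
    have "snd (w \<tau>) - \<epsilon> * G * \<tau> \<le> snd (w 0) - \<epsilon> * G * 0"
    proof (rule DERIV_nonpos_imp_nonincreasing[OF less_imp_le[OF \<tau>]])
      fix t assume t: "0 \<le> t" "t \<le> \<tau>"
      have "((\<lambda>t. snd (w t) - \<epsilon> * G * t) has_real_derivative \<epsilon> * g (w t) - \<epsilon> * G) (at t)"
        by (auto intro!: derivative_eq_intros slow)
      moreover have "\<epsilon> * g (w t) \<le> \<epsilon> * G"
        using g_le[OF w_in[OF t]] \<epsilon> by (intro mult_left_mono) auto
      ultimately show "\<exists>d. ((\<lambda>t. snd (w t) - \<epsilon> * G * t) has_real_derivative d) (at t) \<and> d \<le> 0"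
        by (intro exI conjI) (assumption, simp)
    qed
    then have upper: "snd (w \<tau>) - y \<le> G * \<tau> * \<epsilon>" using w0 by (simp add: algebra_simps)
    have "infdist (fst (w \<tau>)) (range \<gamma>) \<le> infdist (\<psi> \<tau> x) (range \<gamma>) + dist (fst (w \<tau>)) (\<psi> \<tau> x)"
      by (rule infdist_triangle)
    also have "infdist (\<psi> \<tau> x) (range \<gamma>) \<le> \<rho> / 2"
      using contraction(3)[of x] x \<rho> by (simp add: \<tau>_def)
    also have "dist (fst (w \<tau>)) (\<psi> \<tau> x) \<le> \<rho> / 2"
      using dist_fst_le[of "w \<tau>" "u \<tau>"] close[of \<tau>] \<tau> \<kappa> by (simp add: u_def dist_norm)
    finally show "infdist (fst (\<phi> \<epsilon> \<tau> (x, y))) (range \<gamma>) \<le> \<rho> \<and>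
       \<tau> * m / 2 * \<epsilon> \<le> snd (\<phi> \<epsilon> \<tau> (x, y)) - y \<and> snd (\<phi> \<epsilon> \<tau> (x, y)) - y \<le> G * \<tau> * \<epsilon>"
      using lower upper by (simp add: w_def)
  qed
qed

lemma exit_time:
  assumes p: "p \<in> range \<gamma>"
  obtains r \<epsilon>\<^sub>0 where "0 < r" "0 < \<epsilon>\<^sub>0"
    "\<And>\<epsilon>. 0 < \<epsilon> \<Longrightarrow> \<epsilon> \<le> \<epsilon>\<^sub>0 \<Longrightarrow> \<exists>t>0. \<forall>z \<in> ball (p, 0) r. \<phi> \<epsilon> t z \<notin> ball (p, 0) r"
proof -
  obtain \<tau> \<rho> \<eta> c C where pos: "0 < \<tau>" "0 < \<rho>" "0 < \<eta>" "0 < c" "0 < C" and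
    step: "\<And>\<epsilon> x y. 0 < \<epsilon> \<Longrightarrow> \<epsilon> \<le> \<eta> \<Longrightarrow> infdist x (range \<gamma>) \<le> \<rho> \<Longrightarrow> \<bar>y\<bar> \<le> \<eta> \<Longrightarrow>
       infdist (fst (\<phi> \<epsilon> \<tau> (x, y))) (range \<gamma>) \<le> \<rho> \<and>
       c * \<epsilon> \<le> snd (\<phi> \<epsilon> \<tau> (x, y)) - y \<and> snd (\<phi> \<epsilon> \<tau> (x, y)) - y \<le> C * \<epsilon>"
    using drift_step by blast
  \<comment> \<open>In the time in which \<open>y\<close> climbs by \<open>2 r\<close> at the slowest rate, it climbs by \<open>2 r C / c\<close> at the
    fastest. Starting below \<open>r\<close>, it then stays below \<open>r D\<close>, up to one more step of size \<open>C \<epsilon>\<close>.\<close>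
  define D where "D = 1 + 2 * C / c"
  have D: "1 \<le> D" using pos by (simp add: D_def)
  define r where "r = min \<rho> (\<eta> / (2 * D))"
  have r: "0 < r" "r \<le> \<rho>" using pos D by (auto simp: r_def)
  have "r \<le> \<eta> / (2 * D)" by (simp add: r_def)
  then have rD: "r * D \<le> \<eta> / 2" using D by (simp add: field_simps)
  show thesis
  proof (rule that[of r "min \<eta> (\<eta> / (2 * C))"])
    show "0 < r" "0 < min \<eta> (\<eta> / (2 * C))" using r pos by auto
    fix \<epsilon> assume \<epsilon>: "0 < \<epsilon>" "\<epsilon> \<le> min \<eta> (\<eta> / (2 * C))"
    then have "\<epsilon> \<le> \<eta> / (2 * C)" by simp
    then have C\<epsilon>: "C * \<epsilon> \<le> \<eta> / 2" using pos by (simp add: field_simps)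
    have flow': "flow_of (fast_slow_field f g \<epsilon>) (\<phi> \<epsilon>)" using flow \<epsilon> by simp
    define k where "k = nat \<lceil>2 * r / (c * \<epsilon>)\<rceil>"
    have q: "0 < 2 * r / (c * \<epsilon>)" using r pos \<epsilon> by simp
    have k: "2 * r / (c * \<epsilon>) \<le> real k" "real k \<le> 2 * r / (c * \<epsilon>) + 1"
      using q unfolding k_def by linarith+
    have "0 < real k" using k q by linarith
    have k1: "2 * r \<le> real k * (c * \<epsilon>)" using k(1) pos \<epsilon> by (simp add: field_simps)
    have k2: "r + real k * (C * \<epsilon>) \<le> \<eta>"
    proof -
      have "real k * (C * \<epsilon>) \<le> (2 * r / (c * \<epsilon>) + 1) * (C * \<epsilon>)"
        using k(2) pos \<epsilon> by (intro mult_right_mono) auto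
      also have "\<dots> = 2 * r * C / c + C * \<epsilon>" using pos \<epsilon> by (simp add: field_simps)
      finally have "real k * (C * \<epsilon>) \<le> 2 * r * C / c + C * \<epsilon>" .
      moreover have "r * D = r + 2 * r * C / c" by (simp add: D_def algebra_simps)
      ultimately show ?thesis using rD C\<epsilon> by linarith
    qed
    show "\<exists>t>0. \<forall>z \<in> ball (p, 0) r. \<phi> \<epsilon> t z \<notin> ball (p, 0) r"
    proof (intro exI[of _ "real k * \<tau>"] conjI ballI)
      show "0 < real k * \<tau>" using pos \<open>0 < real k\<close> by simp
      fix z :: phase assume z: "z \<in> ball (p, 0) r"
      have "dist (fst z) p < r"
        using z dist_fst_le[of "(p, 0)" z] by (simp add: dist_commute)
      then have z1: "infdist (fst z) (range \<gamma>) \<le> \<rho>"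
        using infdist_le[OF p, of "fst z"] r by simp
      have small_snd: "\<bar>snd z'\<bar> < r" if "z' \<in> ball (p, 0) r" for z' :: phase
        using that dist_snd_le[of "(p, 0)" z'] by (simp add: dist_norm)
      have "infdist (fst (\<phi> \<epsilon> (real j * \<tau>) z)) (range \<gamma>) \<le> \<rho> \<and>
          real j * (c * \<epsilon>) \<le> snd (\<phi> \<epsilon> (real j * \<tau>) z) - snd z \<and>
          snd (\<phi> \<epsilon> (real j * \<tau>) z) - snd z \<le> real j * (C * \<epsilon>)" if "j \<le> k" for j
        using that
      proof (induction j)
        case 0
        then show ?case using z1 by (simp add: flow_ofD[OF flow'])
      next
        case (Suc j)
        define z' where "z' = \<phi> \<epsilon> (real j * \<tau>) z"
        have IH: "infdist (fst z') (range \<gamma>) \<le> \<rho>" "real j * (c * \<epsilon>) \<le> snd z' - snd z"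
            "snd z' - snd z \<le> real j * (C * \<epsilon>)"
          using Suc by (auto simp: z'_def)
        have "real j * (C * \<epsilon>) \<le> real k * (C * \<epsilon>)"
          using Suc.prems pos \<epsilon> by (intro mult_right_mono) auto
        moreover have "0 \<le> real j * (c * \<epsilon>)" using pos \<epsilon> by simp
        ultimately have "\<bar>snd z'\<bar> \<le> \<eta>"
          using IH small_snd[OF z] k2 by linarith
        then have "infdist (fst (\<phi> \<epsilon> \<tau> z')) (range \<gamma>) \<le> \<rho> \<and>
            c * \<epsilon> \<le> snd (\<phi> \<epsilon> \<tau> z') - snd z' \<and> snd (\<phi> \<epsilon> \<tau> z') - snd z' \<le> C * \<epsilon>"
          using step[of \<epsilon> "fst z'" "snd z'"] \<epsilon> IH by simp
        moreover have "\<phi> \<epsilon> \<tau> z' = \<phi> \<epsilon> (real (Suc j) * \<tau>) z"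
          unfolding z'_def
          by (simp add: flow_of_add[OF lipschitz_on_balls_fast_slow_field[OF lf lg] flow'] algebra_simps)
        ultimately show ?case using IH by (simp add: algebra_simps)
      qed
      from this[of k] have "r \<le> snd (\<phi> \<epsilon> (real k * \<tau>) z)"
        using k1 small_snd[OF z] by auto
      then show "\<phi> \<epsilon> (real k * \<tau>) z \<notin> ball (p, 0) r"
        using small_snd[of "\<phi> \<epsilon> (real k * \<tau>) z"] by auto
    qed
  qed
qed

end

section \<open>Forward and backward attraction\<close>

lemma C1_map_compose_linear:
  fixes F :: "'b::real_normed_vector \<Rightarrow> 'c::real_normed_vector"
  assumes "C1_map F" and A: "bounded_linear (A :: 'a::real_normed_vector \<Rightarrow> 'b)"
  shows "C1_map (\<lambda>x. F (A x))"
proof -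
  obtain F' where F': "\<And>z. (F has_derivative blinfun_apply (F' z)) (at z)" "continuous_on UNIV F'"
    using assms(1) unfolding C1_map_def by blast
  show ?thesis
    unfolding C1_map_def
  proof (intro exI[of _ "\<lambda>x. F' (A x) o\<^sub>L Blinfun A"] conjI allI)
    fix z
    have "((\<lambda>x. F (A x)) has_derivative (\<lambda>v. F' (A z) (A v))) (at z)"
      by (rule has_derivative_compose[OF bounded_linear_imp_has_derivative[OF A] F'(1)])
    moreover have "blinfun_apply (F' (A z) o\<^sub>L Blinfun A) = (\<lambda>v. F' (A z) (A v))"
      using A by (simp add: fun_eq_iff bounded_linear_Blinfun_apply)
    ultimately show "((\<lambda>x. F (A x)) has_derivative blinfun_apply (F' (A z) o\<^sub>L Blinfun A)) (at z)"
      by simp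
    show "continuous_on UNIV (\<lambda>x. F' (A x) o\<^sub>L Blinfun A)"
      by (intro bounded_bilinear.continuous_on[OF bounded_bilinear_blinfun_compose] continuous_intros
          continuous_on_compose2[OF F'(2)] linear_continuous_on A) auto
  qed
qed

lemma range_reversed: "range (\<lambda>t :: real. \<gamma> (- t)) = range \<gamma>"
proof -
  have "\<gamma> t \<in> range (\<lambda>t. \<gamma> (- t))" for t
    using rangeI[of "\<lambda>t. \<gamma> (- t)" "- t"] by simp
  then show ?thesis by blast
qed

text \<open>
  The velocity \<open>h\<close> at \<open>\<gamma> 0\<close> is fixed by the monodromy matrix because the time-\<open>T\<close> map is the identity
  on the orbit. If \<open>\<bar>\<mu>\<bar> > 1\<close>, the derivative of the inverse time-\<open>T\<close> map has the same splitting
  with \<open>1 / \<mu>\<close> in place of \<open>\<mu>\<close>.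
\<close>

lemma orbit_attracts_or_repels:
  fixes F :: "real^2 \<Rightarrow> real^2"
  assumes C1: "C1_map F" and flow: "flow_of F \<psi>"
    and hyp: "hyperbolic_periodic_orbit F \<gamma> T"
  obtains (attracting) n :: nat and \<rho> where "1 \<le> n" "0 < \<rho>"
      "\<And>x. infdist x (range \<gamma>) \<le> \<rho> \<Longrightarrow>
        infdist (\<psi> (real n * T) x) (range \<gamma>) \<le> infdist x (range \<gamma>) / 2"
  | (repelling) n :: nat and \<rho> where "1 \<le> n" "0 < \<rho>"
      "\<And>x. infdist x (range \<gamma>) \<le> \<rho> \<Longrightarrow>
        infdist (\<psi> (- (real n * T)) x) (range \<gamma>) \<le> infdist x (range \<gamma>) / 2"
proof -
  obtain F' where F': "\<And>z. (F has_derivative blinfun_apply (F' z)) (at z)" "continuous_on UNIV F'"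
    using C1 unfolding C1_map_def by blast
  have lip: "lipschitz_on_balls F" by (rule C1_map_lipschitz_on_balls[OF C1])
  have T: "0 < T" and orbit: "\<And>t. (\<gamma> has_vector_derivative F (\<gamma> t)) (at t)"
    and per: "\<And>t. \<gamma> (t + T) = \<gamma> t" and nonconst: "\<not> \<gamma> constant_on UNIV"
    using hyp unfolding hyperbolic_periodic_orbit_def periodic_orbit_def by auto
  obtain M X where X0: "X 0 = mat 1"
    and X: "\<And>t. (X has_vector_derivative jacobian F (at (\<gamma> t)) ** X t) (at t)" and XT: "X T = M"
    and simple: "order 1 (complex_charpoly M) = 1"
    and circle: "\<And>\<mu>. poly (complex_charpoly M) \<mu> = 0 \<Longrightarrow> cmod \<mu> = 1 \<Longrightarrow> \<mu> = 1"
    using hyp unfolding hyperbolic_periodic_orbit_def monodromy_matrix_def by blast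
  have jac: "jacobian F (at z) *v v = F' z v" for z v
  proof -
    have "(F has_derivative (\<lambda>h. jacobian F (at z) *v h)) (at z)"
      using F'(1) jacobian_works differentiableI by blast
    from has_derivative_unique[OF this F'(1)] show ?thesis by metis
  qed
  have Y: "((\<lambda>t. X t *v v) has_vector_derivative F' (\<gamma> t) (X t *v v)) (at t)" for t v
  proof -
    have "linear (\<lambda>A :: real^2^2. A *v v)"
      by (simp add: linear_iff matrix_vector_mult_add_rdistrib scaleR_matrix_vector_assoc)
    then have "bounded_linear (\<lambda>A :: real^2^2. A *v v)"
      by (rule linear_conv_bounded_linear[THEN iffD1])
    from bounded_linear.has_vector_derivative[OF this X[of t]] show ?thesis
      by (simp add: jac flip: matrix_vector_mul_assoc)
  qed
  have DP: "(\<psi> T has_derivative (\<lambda>v. M *v v)) (at (\<gamma> 0))"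
    using flow_has_derivative[of F F' \<psi> \<gamma> "\<lambda>t v. X t *v v" T, OF F' flow orbit _ Y] T
    by (simp add: X0 XT)
  have \<psi>\<gamma>: "\<psi> t (\<gamma> s) = \<gamma> (s + t)" for s t
    by (rule flow_of_solution[OF lip flow orbit])
  define h where "h = F (\<gamma> 0)"
  have \<gamma>h: "(\<gamma> has_vector_derivative h) (at 0)" unfolding h_def by (rule orbit)
  have "((\<lambda>s. \<psi> T (\<gamma> s)) has_derivative (\<lambda>s. M *v (s *\<^sub>R h))) (at 0)"
    using has_derivative_compose[OF \<gamma>h[unfolded has_vector_derivative_def] DP] .
  then have "(\<gamma> has_derivative (\<lambda>s. M *v (s *\<^sub>R h))) (at 0)"
    by (simp add: \<psi>\<gamma> per)
  from has_derivative_unique[OF this \<gamma>h[unfolded has_vector_derivative_def]]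
  have Mh: "M *v h = h" by (metis scaleR_one)
  have "h \<noteq> 0"
  proof
    assume "h = 0"
    have "\<gamma> t = \<gamma> 0" for t
      by (rule solution_unique[of F \<gamma> "\<lambda>_. \<gamma> 0", OF lip orbit])
         (use \<open>h = 0\<close> in \<open>simp_all add: h_def\<close>)
    then show False using nonconst unfolding constant_on_def by metis
  qed
  then obtain \<mu> C where \<mu>: "\<bar>\<mu>\<bar> \<noteq> 1" and C: "0 \<le> C" and
    split: "\<And>v. \<exists>a. \<bar>a\<bar> \<le> C * norm v \<and> M *v (v - a *\<^sub>R h) = \<mu> *\<^sub>R (v - a *\<^sub>R h)"
    using hyperbolic_splitting[OF _ Mh simple circle] by blast
  have fixed: "\<psi> T (\<gamma> 0) = \<gamma> 0" using \<psi>\<gamma> per[of 0] by simp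
  show thesis
  proof (cases "\<bar>\<mu>\<bar> < 1")
    case True
    have "\<exists>k. \<exists>\<delta>>0. \<forall>x. dist x (\<gamma> 0) < \<delta> \<longrightarrow>
        infdist ((\<psi> T ^^ k) x) (range \<gamma>) \<le> q * dist x (\<gamma> 0)" if "0 < q" for q
      by (rule contraction_at_fixed_point[OF DP fixed \<gamma>h refl Mh split C True that])
    then show thesis
      using orbit_contraction[of F \<psi> \<gamma> T, OF lip flow orbit per T] attracting by metis
  next
    case False
    define \<psi>' where "\<psi>' t = \<psi> (- t)" for t
    define \<gamma>' where "\<gamma>' t = \<gamma> (- t)" for t
    define D where "D v = X (- T) *v v" for v
    have range: "range \<gamma>' = range \<gamma>"
      unfolding \<gamma>'_def by (rule range_reversed)
    have orbit': "(\<gamma>' has_vector_derivative - F (\<gamma>' t)) (at t)" for t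
      unfolding \<gamma>'_def by (rule reversed_solution[of \<gamma> F, OF orbit])
    have per': "\<gamma>' (t + T) = \<gamma>' t" for t
      using per[of "- t - T"] by (simp add: \<gamma>'_def)
    have flow': "flow_of (\<lambda>z. - F z) \<psi>'"
      unfolding \<psi>'_def[abs_def] by (rule flow_of_reversed[OF flow])
    have "((\<lambda>z. - F z) has_derivative blinfun_apply (- F' z)) (at z)" for z
      using has_derivative_minus[OF F'(1)] by (simp add: uminus_blinfun.rep_eq)
    moreover have "((\<lambda>t. X (- t) *v v) has_vector_derivative (- F' (\<gamma>' t)) (X (- t) *v v)) (at t)"
      for t v
      using has_vector_derivative_affine[of "\<lambda>t. X t *v v" "F' (\<gamma> (- t)) (X (- t) *v v)" 0 "-1" t] Y[of v "- t"]
      by (simp add: \<gamma>'_def uminus_blinfun.rep_eq)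
    ultimately have DP': "(\<psi>' T has_derivative D) (at (\<gamma> 0))"
      using flow_has_derivative[of "\<lambda>z. - F z" "\<lambda>z. - F' z" \<psi>' \<gamma>' "\<lambda>t v. X (- t) *v v" T]
        flow' orbit' F'(2) T
      by (simp add: continuous_on_minus X0 D_def[abs_def] \<gamma>'_def)
    \<comment> \<open>Differentiate \<open>\<psi> (-T) (\<psi> T x) = x\<close> at \<open>\<gamma> 0\<close>.\<close>
    have DM: "D (M *v v) = v" for v
    proof -
      have "(\<psi>' T has_derivative D) (at (\<psi> T (\<gamma> 0)))" using DP' fixed by simp
      from has_derivative_compose[OF DP this]
      have "((\<lambda>x. x) has_derivative (\<lambda>v. D (M *v v))) (at (\<gamma> 0))"
        by (simp add: \<psi>'_def flow_of_add[OF lip flow] flow_ofD[OF flow])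
      from has_derivative_unique[OF this has_derivative_ident] show ?thesis by metis
    qed
    have D_scale: "D (c *\<^sub>R w) = c *\<^sub>R D w" for c w
      by (simp add: D_def matrix_vector_mult_scaleR)
    have split': "\<exists>a. \<bar>a\<bar> \<le> C * norm v \<and> D (v - a *\<^sub>R h) = (1 / \<mu>) *\<^sub>R (v - a *\<^sub>R h)" for v
    proof -
      obtain a where a: "\<bar>a\<bar> \<le> C * norm v" "M *v (v - a *\<^sub>R h) = \<mu> *\<^sub>R (v - a *\<^sub>R h)"
        using split by blast
      have "v - a *\<^sub>R h = \<mu> *\<^sub>R D (v - a *\<^sub>R h)"
        using DM[of "v - a *\<^sub>R h"] by (simp only: a(2) D_scale)
      then have "(1 / \<mu>) *\<^sub>R (v - a *\<^sub>R h) = (1 / \<mu>) *\<^sub>R (\<mu> *\<^sub>R D (v - a *\<^sub>R h))" by simp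
      also have "\<dots> = D (v - a *\<^sub>R h)" using False by simp
      finally show ?thesis using a(1) by metis
    qed
    have fixed': "\<psi>' T (\<gamma> 0) = \<gamma> 0"
      using \<psi>\<gamma>[of "- T" 0] per[of "- T"] by (simp add: \<psi>'_def)
    have Dh: "D h = h" using DM[of h] Mh by simp
    have \<mu>': "\<bar>1 / \<mu>\<bar> < 1" using False \<mu> by (simp add: abs_divide)
    have "\<exists>k. \<exists>\<delta>>0. \<forall>x. dist x (\<gamma>' 0) < \<delta> \<longrightarrow>
        infdist ((\<psi>' T ^^ k) x) (range \<gamma>') \<le> q * dist x (\<gamma>' 0)" if "0 < q" for q
      using contraction_at_fixed_point[OF DP' fixed' \<gamma>h refl Dh split' C \<mu>' that]
      unfolding range by (simp add: \<gamma>'_def)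
    then obtain n :: nat and \<rho> where "1 \<le> n" "0 < \<rho>"
      "\<And>x. infdist x (range \<gamma>') \<le> \<rho> \<Longrightarrow>
        infdist (\<psi>' (real n * T) x) (range \<gamma>') \<le> infdist x (range \<gamma>') / 2"
      using orbit_contraction[of "\<lambda>z. - F z" \<psi>' \<gamma>' T,
          OF lipschitz_on_balls_uminus[OF lip] flow' orbit' per' T] by metis
    then show thesis unfolding range \<psi>'_def by (rule repelling)
  qed
qed

section \<open>Reversal of time and averages along the orbit\<close>

definition reflect_slow :: "phase \<Rightarrow> phase" where
  "reflect_slow z = (fst z, - snd z)"

lemma reflect_slow_simps [simp]:
  "reflect_slow (reflect_slow z) = z" "norm (reflect_slow z) = norm z"
  "dist (p, 0) (reflect_slow z) = dist (p, 0) z"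
  by (cases z; simp add: reflect_slow_def norm_Pair dist_Pair_Pair dist_norm)+

lemma bounded_linear_reflect_slow: "bounded_linear reflect_slow"
  unfolding reflect_slow_def[abs_def]
  by (intro bounded_linear_Pair bounded_linear_fst bounded_linear_minus bounded_linear_snd)

text \<open>
  Reflecting \<open>y\<close> as well as \<open>t\<close> cancels the sign of \<open>\<epsilon> g\<close>, so that the reversed system is again
  fast-slow with the same nonnegative \<open>\<epsilon>\<close>.
\<close>

lemma reversed_fast_slow_flow:
  assumes "flow_of (fast_slow_field f g \<epsilon>) \<phi>"
  shows "flow_of (fast_slow_field (\<lambda>z. - f (reflect_slow z)) (\<lambda>z. g (reflect_slow z)) \<epsilon>)
    (\<lambda>t z. reflect_slow (\<phi> (- t) (reflect_slow z)))"
  unfolding flow_of_def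
proof (intro allI conjI)
  fix z t
  show "reflect_slow (\<phi> (- 0) (reflect_slow z)) = z" by (simp add: flow_ofD[OF assms])
  have "((\<lambda>t. \<phi> (- t) (reflect_slow z)) has_vector_derivative
      - fast_slow_field f g \<epsilon> (\<phi> (- t) (reflect_slow z))) (at t)"
    by (rule reversed_solution[of "\<lambda>t. \<phi> t (reflect_slow z)" "fast_slow_field f g \<epsilon>"])
       (rule flow_ofD[OF assms])
  from bounded_linear.has_vector_derivative[OF bounded_linear_reflect_slow this]
  show "((\<lambda>t. reflect_slow (\<phi> (- t) (reflect_slow z))) has_vector_derivative
      fast_slow_field (\<lambda>z. - f (reflect_slow z)) (\<lambda>z. g (reflect_slow z)) \<epsilon>
        (reflect_slow (\<phi> (- t) (reflect_slow z)))) (at t)"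
    by (simp add: fast_slow_field_def reflect_slow_def)
qed

lemma fast_flow_at_zero:
  assumes "flow_of (fast_slow_field f g 0) \<phi>"
  shows "\<phi> t (x, 0) = (fst (\<phi> t (x, 0)), 0)"
    and "flow_of (\<lambda>x. f (x, 0)) (\<lambda>t x. fst (\<phi> t (x, 0)))"
proof -
  have der: "((\<lambda>t. \<phi> t (x, 0)) has_vector_derivative (f (\<phi> t (x, 0)), 0)) (at t)" for t x
    using flow_ofD(2)[OF assms, of "(x, 0)" t] by (simp add: fast_slow_field_def)
  have "((\<lambda>t. snd (\<phi> t (x, 0))) has_real_derivative 0) (at t)" for t x
    using bounded_linear.has_vector_derivative[OF bounded_linear_snd der[of x t]]
    by (simp add: has_real_derivative_iff_has_vector_derivative)
  then have "snd (\<phi> t (x, 0)) = snd (\<phi> 0 (x, 0))" for t x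
    by (intro DERIV_isconst_all) auto
  then have snd0: "snd (\<phi> t (x, 0)) = 0" for t x by (simp add: flow_ofD[OF assms])
  then show eq: "\<phi> t (x, 0) = (fst (\<phi> t (x, 0)), 0)" for t x by (simp add: prod_eq_iff)
  show "flow_of (\<lambda>x. f (x, 0)) (\<lambda>t x. fst (\<phi> t (x, 0)))"
    unfolding flow_of_def
  proof (intro allI conjI)
    fix t x
    show "fst (\<phi> 0 (x, 0)) = x" by (simp add: flow_ofD[OF assms])
    show "((\<lambda>t. fst (\<phi> t (x, 0))) has_vector_derivative f (fst (\<phi> t (x, 0)), 0)) (at t)"
      using bounded_linear.has_vector_derivative[OF bounded_linear_fst der[of x t]] eq[of t x] by simp
  qed
qed

lemma periodic_antiderivative:
  fixes G :: "real \<Rightarrow> real"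
  assumes cont: "continuous_on UNIV G" and per: "\<And>t. G (t + T) = G t" and T: "0 \<le> T"
  obtains J where "\<And>t. (J has_real_derivative G t) (at t)"
    "\<And>t. J (t + T) = J t + integral {0..T} G"
proof -
  have "isCont G t" for t using cont by (simp add: continuous_on_eq_continuous_at)
  then obtain J where J: "\<And>t. (J has_real_derivative G t) (at t)"
    using einterval_antiderivative[of "-\<infinity>" "\<infinity>" G]
    by (auto simp: has_real_derivative_iff_has_vector_derivative)
  have "((\<lambda>t. J (t + T) - J t) has_real_derivative 0) (at t)" for t
    using DERIV_diff[OF DERIV_shift[THEN iffD1, OF J[of "t + T"]] J[of t]] per by simp
  then have "J (t + T) - J t = J (0 + T) - J 0" for t
    using DERIV_isconst_all[of "\<lambda>t. J (t + T) - J t" t 0] by simp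
  moreover have "(G has_integral (J T - J 0)) {0..T}"
    using J by (intro fundamental_theorem_of_calculus T)
      (auto simp: has_real_derivative_iff_has_vector_derivative intro: has_vector_derivative_at_within)
  ultimately show thesis using that[OF J] by (simp add: integral_unique algebra_simps)
qed

lemma compact_square: "compact (square K)"
proof -
  have "square K = cbox (\<chi> i. - K) (\<chi> i. K)"
    by (auto simp: square_def mem_box_cart)
  then show ?thesis by simp
qed

section \<open>Points of the orbit are slow exit points\<close>

theorem proposition5p1:
  fixes f :: "(real^2) \<times> real \<Rightarrow> real^2"
    and g :: "(real^2) \<times> real \<Rightarrow> real"
    and \<phi> :: "real \<Rightarrow> real \<Rightarrow> (real^2) \<times> real \<Rightarrow> (real^2) \<times> real"
    and \<gamma> :: "real \<Rightarrow> real \<Rightarrow> real^2"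
    and T :: "real \<Rightarrow> real"
    and K \<delta>\<^sub>0 :: real
    and N :: "((real^2) \<times> real) set"
  assumes smooth: "C1_map f" "C1_map g"
    and flow: "\<And>\<epsilon>. \<epsilon> \<ge> 0 \<Longrightarrow> flow_of (fast_slow_field f g \<epsilon>) (\<phi> \<epsilon>)"
    and K: "K > 0"
    and N: "N = square K \<times> {-K..0}"
    and delta: "\<delta>\<^sub>0 > 0"
    and B1: "\<And>y. y \<in> {-\<delta>\<^sub>0..\<delta>\<^sub>0} \<Longrightarrow>
               hyperbolic_periodic_orbit (\<lambda>x. f (x, y)) (\<gamma> y) (T y)"
    and B2: "\<And>y. y \<in> {-\<delta>\<^sub>0..0} \<Longrightarrow> lifted_orbit \<gamma> y \<subseteq> N"
            "lifted_orbit \<gamma> 0 \<subseteq>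
               (top_of_set {p. snd p = 0}) interior_of (square K \<times> {0})"
    and average: "1 / T 0 * integral {0..T 0} (\<lambda>s. g (\<gamma> 0 s, 0)) > 0"
  shows "\<forall>z \<in> lifted_orbit \<gamma> 0. slow_exit_point \<phi> N z"
proof -
  define F where "F x = f (x, 0)" for x
  define \<psi> where "\<psi> t x = fst (\<phi> 0 t (x, 0))" for t x
  define I where "I = integral {0..T 0} (\<lambda>s. g (\<gamma> 0 s, 0))"
  have lf: "lipschitz_on_balls f" and lg: "lipschitz_on_balls g"
    using smooth by (auto intro: C1_map_lipschitz_on_balls)
  have hyp: "hyperbolic_periodic_orbit F (\<gamma> 0) (T 0)"
    using B1[of 0] delta by (simp add: F_def[abs_def])
  have fast_flow: "flow_of (\<lambda>x. f (x, 0)) \<psi>"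
    unfolding \<psi>_def[abs_def] by (rule fast_flow_at_zero(2)[OF flow]) simp
  have T: "0 < T 0" and orbit: "\<And>t. (\<gamma> 0 has_vector_derivative f (\<gamma> 0 t, 0)) (at t)"
    and per: "\<And>t. \<gamma> 0 (t + T 0) = \<gamma> 0 t"
    using hyp unfolding hyperbolic_periodic_orbit_def periodic_orbit_def F_def by auto
  have C1F: "C1_map F"
    unfolding F_def[abs_def]
    by (rule C1_map_compose_linear[OF smooth(1)])
       (intro bounded_linear_Pair bounded_linear_ident bounded_linear_zero)
  have I: "0 < I" using average T by (simp add: I_def zero_less_divide_iff)
  have "continuous_on UNIV (\<lambda>t. g (\<gamma> 0 t, 0))"
  proof -
    have g: "continuous_on UNIV g"
      using smooth(2) unfolding C1_map_def
      by (meson continuous_at_imp_continuous_on has_derivative_continuous)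
    have \<gamma>: "continuous_on UNIV (\<gamma> 0)"
      using orbit by (meson continuous_at_imp_continuous_on has_vector_derivative_continuous)
    show ?thesis
      by (rule continuous_on_compose2[OF g continuous_on_Pair[OF \<gamma> continuous_on_const]]) simp
  qed
  then obtain J where J: "\<And>t. (J has_real_derivative g (\<gamma> 0 t, 0)) (at t)"
    and JT: "\<And>t. J (t + T 0) = J t + I"
    using periodic_antiderivative[of "\<lambda>t. g (\<gamma> 0 t, 0)" "T 0"] per T unfolding I_def by auto
  have exit: "\<exists>r \<epsilon>\<^sub>0. 0 < r \<and> 0 < \<epsilon>\<^sub>0 \<and> (\<forall>\<epsilon>. 0 < \<epsilon> \<and> \<epsilon> \<le> \<epsilon>\<^sub>0 \<longrightarrow>
      (\<exists>t>0. \<forall>z \<in> ball (p, 0) r. \<phi> \<epsilon> t z \<notin> ball (p, 0) r))"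
    if p: "p \<in> range (\<gamma> 0)" for p
    using C1F fast_flow[folded F_def] hyp
  proof (cases rule: orbit_attracts_or_repels)
    case (attracting n \<rho>)
    interpret forward: attracting_orbit_with_drift f g \<phi> \<psi> "\<gamma> 0" "T 0" I \<rho> J n
      by (intro attracting_orbit_with_drift.intro lf lg flow fast_flow orbit per T J JT I attracting)
    show ?thesis using forward.exit_time[OF p] by metis
  next
    case (repelling n \<rho>)
    define \<gamma>' where "\<gamma>' t = \<gamma> 0 (- t)" for t
    have range: "range \<gamma>' = range (\<gamma> 0)"
      unfolding \<gamma>'_def by (rule range_reversed)
    interpret backward: attracting_orbit_with_drift "\<lambda>z. - f (reflect_slow z)" "\<lambda>z. g (reflect_slow z)"
      "\<lambda>\<epsilon> t z. reflect_slow (\<phi> \<epsilon> (- t) (reflect_slow z))" "\<lambda>t. \<psi> (- t)" \<gamma>' "T 0" I \<rho>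
      "\<lambda>t. - J (- t)" n
    proof unfold_locales
      have lin: "linear reflect_slow"
        using bounded_linear_reflect_slow by (rule bounded_linear.linear)
      show "lipschitz_on_balls (\<lambda>z. - f (reflect_slow z))"
        by (intro lipschitz_on_balls_uminus lipschitz_on_balls_isometry[OF lf lin]) simp
      show "lipschitz_on_balls (\<lambda>z. g (reflect_slow z))"
        by (intro lipschitz_on_balls_isometry[OF lg lin]) simp
      show "flow_of (fast_slow_field (\<lambda>z. - f (reflect_slow z)) (\<lambda>z. g (reflect_slow z)) \<epsilon>)
          (\<lambda>t z. reflect_slow (\<phi> \<epsilon> (- t) (reflect_slow z)))" if "0 \<le> \<epsilon>" for \<epsilon>
        by (rule reversed_fast_slow_flow[OF flow[OF that]])
      show "flow_of (\<lambda>x. - f (reflect_slow (x, 0))) (\<lambda>t. \<psi> (- t))"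
        using flow_of_reversed[OF fast_flow] by (simp add: reflect_slow_def)
      show "(\<gamma>' has_vector_derivative - f (reflect_slow (\<gamma>' t, 0))) (at t)" for t
        using reversed_solution[of "\<gamma> 0" "\<lambda>x. f (x, 0)", OF orbit, of t]
        by (simp add: reflect_slow_def \<gamma>'_def[abs_def])
      show "\<gamma>' (t + T 0) = \<gamma>' t" for t using per[of "- t - T 0"] by (simp add: \<gamma>'_def)
      show "((\<lambda>t. - J (- t)) has_real_derivative g (reflect_slow (\<gamma>' t, 0))) (at t)" for t
        using DERIV_minus[OF DERIV_mirror[THEN iffD1, OF J[of "- t"]]]
        by (simp add: reflect_slow_def \<gamma>'_def)
      show "- J (- (t + T 0)) = - J (- t) + I" for t
        using JT[of "- t - T 0"] by simp
      show "infdist (\<psi> (- (real n * T 0)) x) (range \<gamma>') \<le> infdist x (range \<gamma>') / 2"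
        if "infdist x (range \<gamma>') \<le> \<rho>" for x
        using repelling(3) that unfolding range by blast
    qed (use T I repelling in auto)
    obtain r \<epsilon>\<^sub>0 where r: "0 < r" "0 < \<epsilon>\<^sub>0" and
      out: "\<And>\<epsilon>. 0 < \<epsilon> \<Longrightarrow> \<epsilon> \<le> \<epsilon>\<^sub>0 \<Longrightarrow> \<exists>t>0. \<forall>z \<in> ball (p, 0) r.
        reflect_slow (\<phi> \<epsilon> (- t) (reflect_slow z)) \<notin> ball (p, 0) r"
      using backward.exit_time[of p] p unfolding range by blast
    \<comment> \<open>A point of the ball that is in the ball at time \<open>t\<close> would be brought back into the ball by time \<open>-t\<close>.\<close>
    have "\<exists>t>0. \<forall>z \<in> ball (p, 0) r. \<phi> \<epsilon> t z \<notin> ball (p, 0) r" if \<epsilon>: "0 < \<epsilon>" "\<epsilon> \<le> \<epsilon>\<^sub>0" for \<epsilon>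
    proof -
      obtain t where t: "0 < t" "\<And>z. z \<in> ball (p, 0) r \<Longrightarrow>
          reflect_slow (\<phi> \<epsilon> (- t) (reflect_slow z)) \<notin> ball (p, 0) r"
        using out[OF \<epsilon>] by blast
      have flow\<epsilon>: "flow_of (fast_slow_field f g \<epsilon>) (\<phi> \<epsilon>)" using flow \<epsilon> by simp
      have "\<phi> \<epsilon> t z \<notin> ball (p, 0) r" if "z \<in> ball (p, 0) r" for z
      proof
        assume "\<phi> \<epsilon> t z \<in> ball (p, 0) r"
        then have "\<phi> \<epsilon> (- t) (\<phi> \<epsilon> t z) \<notin> ball (p, 0) r"
          using t(2)[of "reflect_slow (\<phi> \<epsilon> t z)"] by simp
        then show False
          using that
          by (simp add: flow_of_add[OF lipschitz_on_balls_fast_slow_field[OF lf lg] flow\<epsilon>]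
              flow_ofD[OF flow\<epsilon>])
      qed
      with t(1) show ?thesis by blast
    qed
    with r show ?thesis by blast
  qed
  show ?thesis
  proof
    fix z assume z: "z \<in> lifted_orbit \<gamma> 0"
    then obtain s where s: "z = (\<gamma> 0 s, 0)" by (auto simp: lifted_orbit_def)
    obtain r \<epsilon>\<^sub>0 where r: "0 < r" "0 < \<epsilon>\<^sub>0" and
      out: "\<And>\<epsilon>. 0 < \<epsilon> \<Longrightarrow> \<epsilon> \<le> \<epsilon>\<^sub>0 \<Longrightarrow> \<exists>t>0. \<forall>z' \<in> ball z r. \<phi> \<epsilon> t z' \<notin> ball z r"
      using exit[of "\<gamma> 0 s"] unfolding s by blast
    have "compact N" unfolding N by (intro compact_Times compact_square) simp
    moreover have "z \<in> Inv N (\<phi> 0)"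
    proof -
      have "\<phi> 0 t z = (\<gamma> 0 (s + t), 0)" for t
      proof -
        have "lipschitz_on_balls F" by (rule C1_map_lipschitz_on_balls[OF C1F])
        then have "\<psi> t (\<gamma> 0 s) = \<gamma> 0 (s + t)"
          unfolding F_def[abs_def] by (rule flow_of_solution[OF _ fast_flow orbit])
        then show ?thesis
          using fast_flow_at_zero(1)[OF flow[of 0], of t "\<gamma> 0 s"] by (simp add: s \<psi>_def)
      qed
      then have "\<phi> 0 t z \<in> lifted_orbit \<gamma> 0" for t by (auto simp: lifted_orbit_def)
      then show ?thesis using B2(1)[of 0] delta unfolding Inv_def by auto
    qed
    moreover have "z \<in> interior (ball z r)" using r by (simp add: interior_open)
    moreover have "\<exists>t>0. \<phi> \<epsilon> t ` ball z r \<inter> ball z r = {}" if "0 < \<epsilon>" "\<epsilon> \<le> \<epsilon>\<^sub>0" for \<epsilon>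
      using out[OF that] by blast
    ultimately show "slow_exit_point \<phi> N z" unfolding slow_exit_point_def using r(2) by blast
  qed
qed

end
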